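(* For every negative integer $-T$ (that is, for every integer $T \geq 1$) there is a Salem number of trace $-T$ and degree at most $\exp\exp(22+4T\log T)$.
   Context: A Salem number is a real algebraic integer greater than $1$ whose other conjugates over $\mathbb{Q}$ all lie in the closed disc $|z|\leq 1$, with at least one conjugate on $|z|=1$. The degree and trace of an algebraic integer are the degree of its minimal polynomial over $\mathbb{Q}$ and the sum of the zeros of that minimal polynomial, respectively. $\log$ is the natural logarithm. *)

theory Defs
  imports "HOL-Analysis.Analysis" "HOL-Computational_Algebra.Computational_Algebra"
    "HOL-Computational_Algebra.Field_as_Ring"
begin

definition is_minimal_poly :: "'a::field_char_0 \<Rightarrow> rat poly \<Rightarrow> bool" where
  "is_minimal_poly x p \<longleftrightarrow>
     lead_coeff p = 1 \<and> irreducible p \<and> poly (map_poly of_rat p) x = 0"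

text \<open>Unspecified when \<open>x\<close> is not algebraic; see \<open>ex1_is_minimal_poly\<close>.\<close>

definition minimal_poly :: "'a::field_char_0 \<Rightarrow> rat poly" where
  "minimal_poly x = (THE p. is_minimal_poly x p)"

text \<open>All complex conjugates over the rationals, including \<open>x\<close> itself.\<close>

definition conjugates :: "'a::field_char_0 \<Rightarrow> complex set" where
  "conjugates x = {z. poly (map_poly of_rat (minimal_poly x)) z = 0}"

definition alg_degree :: "'a::field_char_0 \<Rightarrow> nat" where
  "alg_degree x = degree (minimal_poly x)"

definition alg_trace :: "'a::field_char_0 \<Rightarrow> complex" where
  "alg_trace x = \<Sum>\<^sub># (proots (map_poly of_rat (minimal_poly x)))"

definition salem_number :: "real \<Rightarrow> bool" where
  "salem_number \<alpha> \<longleftrightarrow>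
     algebraic_int \<alpha> \<and> \<alpha> > 1 \<and>
     (\<forall>z \<in> conjugates \<alpha> - {complex_of_real \<alpha>}. norm z \<le> 1) \<and>
     (\<exists>z \<in> conjugates \<alpha>. norm z = 1)"

lemma map_poly_of_rat_mult:
  "map_poly (of_rat :: rat \<Rightarrow> 'a::field_char_0) (p * q) = map_poly of_rat p * map_poly of_rat q"
  by (rule poly_eqI) (simp add: coeff_map_poly coeff_mult of_rat_sum of_rat_mult)

lemma map_poly_of_rat_add:
  "map_poly (of_rat :: rat \<Rightarrow> 'a::field_char_0) (p + q) = map_poly of_rat p + map_poly of_rat q"
  by (rule poly_eqI) (simp add: coeff_map_poly of_rat_add)

lemma poly_of_rat_eq_0_mult:
  "poly (map_poly of_rat (p * q)) (x::'a::field_char_0) = 0 \<longleftrightarrow>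
     poly (map_poly of_rat p) x = 0 \<or> poly (map_poly of_rat q) x = 0"
  by (simp add: map_poly_of_rat_mult)

lemma is_minimal_poly_dvd:
  fixes x :: "'a::field_char_0"
  assumes p: "is_minimal_poly x p" and q: "poly (map_poly of_rat q) x = 0"
  shows "p dvd q"
proof (rule ccontr)
  assume "\<not> p dvd q"
  moreover have "prime_elem p"
    using p by (auto simp: is_minimal_poly_def intro: field_poly_irreducible_imp_prime)
  ultimately have "coprime p q"
    using prime_elem_imp_coprime by blast
  then obtain a b where "a * p + b * q = 1"
    using bezout_coefficients_fst_snd[of p q] by (auto simp: coprime_iff_gcd_eq_1)
  hence "poly (map_poly of_rat (a * p + b * q)) x = poly (map_poly of_rat 1) x"
    by simp
  thus False
    using p q by (simp add: is_minimal_poly_def map_poly_of_rat_add map_poly_of_rat_mult)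
qed

lemma is_minimal_poly_unique:
  fixes x :: "'a::field_char_0"
  assumes "is_minimal_poly x p" and "is_minimal_poly x q"
  shows "p = q"
proof -
  have "normalize p = normalize q"
    using assms by (intro associatedI is_minimal_poly_dvd) (auto simp: is_minimal_poly_def)
  moreover have "normalize r = r" if "lead_coeff r = 1" for r :: "rat poly"
    using that by (simp add: normalize_poly_eq_map_poly)
  ultimately show ?thesis
    using assms by (simp add: is_minimal_poly_def)
qed

lemma ex_is_minimal_poly:
  fixes x :: "'a::field_char_0"
  assumes "p \<noteq> 0" and "poly (map_poly of_rat p) x = 0"
  shows "\<exists>q. is_minimal_poly x q"
  using assms
proof (induction "degree p" arbitrary: p rule: less_induct)
  case less
  show ?case
  proof (cases "irreducible p")
    case True
    let ?q = "smult (inverse (lead_coeff p)) p"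
    have "irreducible ?q"
    proof -
      have "?q = [:inverse (lead_coeff p):] * p" by simp
      moreover have "is_unit [:inverse (lead_coeff p):]"
        using less.prems by (simp add: is_unit_const_poly_iff dvd_field_iff)
      ultimately show ?thesis
        using True by (metis irreducible_mult_unit_left)
    qed
    moreover have "poly (map_poly of_rat ?q) x = 0"
      using less.prems poly_of_rat_eq_0_mult[of "[:inverse (lead_coeff p):]" p x] by simp
    moreover have "lead_coeff ?q = 1"
      using less.prems by simp
    ultimately show ?thesis
      unfolding is_minimal_poly_def by blast
  next
    case False
    have "degree p \<noteq> 0"
    proof
      assume "degree p = 0"
      then obtain c where "p = [:c:]" by (rule degree_eq_zeroE)
      thus False using less.prems by (simp add: map_poly_pCons)
    qed
    hence "\<not> is_unit p" using less.prems by (simp add: is_unit_iff_degree)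
    with False less.prems obtain a b where ab: "p = a * b" "\<not> is_unit a" "\<not> is_unit b"
      unfolding irreducible_def by blast
    with less.prems have nz: "a \<noteq> 0" "b \<noteq> 0" by auto
    with ab have "degree a < degree p" "degree b < degree p"
      by (auto simp: degree_mult_eq is_unit_iff_degree)
    moreover have "poly (map_poly of_rat a) x = 0 \<or> poly (map_poly of_rat b) x = 0"
      using less.prems ab poly_of_rat_eq_0_mult by blast
    ultimately show ?thesis using less.hyps nz by blast
  qed
qed

lemma ex1_is_minimal_poly:
  fixes x :: "'a::field_char_0"
  assumes "algebraic x"
  shows "\<exists>!p. is_minimal_poly x p"
proof -
  from assms obtain p where p: "\<And>i. coeff p i \<in> \<int>" "p \<noteq> 0" "poly p x = 0"
    by (auto simp: algebraic_def)
  define r :: "rat poly" where "r = map_poly (\<lambda>c. of_int (SOME n. c = of_int n)) p"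
  have c0: "(SOME n. (0::'a) = of_int n) = 0"
    by (rule some_equality) auto
  have "map_poly of_rat r = p"
  proof (rule poly_eqI)
    fix i
    have "\<exists>n. coeff p i = of_int n" using p(1)[of i] by (auto elim: Ints_cases)
    from someI_ex[OF this] show "coeff (map_poly of_rat r) i = coeff p i"
      by (simp add: r_def coeff_map_poly c0)
  qed
  hence "r \<noteq> 0" "poly (map_poly of_rat r) x = 0" using p by auto
  thus ?thesis using ex_is_minimal_poly is_minimal_poly_unique by blast
qed

lemma is_minimal_poly_minimal_poly:
  fixes x :: "'a::field_char_0"
  assumes "algebraic x"
  shows "is_minimal_poly x (minimal_poly x)"
  unfolding minimal_poly_def by (rule theI'[OF ex1_is_minimal_poly[OF assms]])

end

theory Submission
  imports Defs "HOL-Number_Theory.Cong"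
begin

text \<open>Let \<open>a\<^sub>0 = 1, a\<^sub>1 = 2, a\<^sub>2, \<dots>\<close> be \<open>2m\<close> pairwise coprime exponents and consider the equation
  \<open>z - 1/z = \<Sum>\<^sub>i (1/2 + 1/(z\<^bsup>a\<^sub>i\<^esup> - 1))\<close>. Clearing denominators yields a monic integer polynomial \<open>P\<close>
  whose trace is \<open>2 - m\<close>, since each cyclotomic quotient \<open>(z\<^bsup>a\<^sub>i\<^esup> - 1)/(z - 1)\<close> in the common
  denominator contributes \<open>-1\<close> and the value \<open>m\<close> of the right-hand side at infinity gives back half.

  Both sides are odd under \<open>z \<mapsto> 1/z\<close>. Outside the unit disc, the right-hand side gives rise to a
  positive semidefinite kernel, which forces \<open>P\<close> to have at most one zero there; it has one by the
  intermediate value theorem. So \<open>P\<close> is a Salem polynomial times cyclotomic polynomials.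

  On the unit circle the equation reads
  \<open>4 sin \<theta> + \<Sum>\<^sub>i cot (a\<^sub>i \<theta>/2) = 0\<close>. If \<open>P\<close> had a cyclotomic factor, it would vanish at some
  \<open>exp(2 \<pi> \<i>/n)\<close>. But if every \<open>a\<^sub>j - 1\<close> is divisible by all \<open>a\<^sub>i + r\<close> with \<open>i < j\<close> and \<open>r\<close> small, then
  at most one \<open>a\<^sub>i\<close> is congruent modulo \<open>n\<close> to a small negative number, so the two terms with
  \<open>a\<^sub>0 = 1\<close> and \<open>a\<^sub>1 = 2\<close> outweigh all negative ones. Hence \<open>P\<close> is irreducible. Such \<open>a\<^sub>i\<close> exist with
  doubly exponential size.

  That an irreducible integer polynomial \<open>h\<close> with all its roots in the unit disc vanishes at some
  \<open>exp(2 \<pi> \<i>/n)\<close> (Kronecker's theorem together with the irreducibility of cyclotomic polynomials)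
  follows from \<open>h(x\<^sup>p) \<equiv> h(x)\<^sup>p\<close> modulo \<open>p\<close>: for a large prime \<open>p\<close>, the value \<open>h(z\<^sup>p)\<close>
  at a root \<open>z\<close> is \<open>p\<close> times an integer combination of powers of \<open>z\<close> with only tiny conjugates, so it
  is \<open>0\<close>.\<close>

section \<open>Polynomials with integer coefficients\<close>

abbreviation of_int_poly :: "int poly \<Rightarrow> 'a::comm_ring_1 poly" where
  "of_int_poly \<equiv> map_poly of_int"

lemma of_int_poly_add: "of_int_poly (p + q) = of_int_poly p + of_int_poly q"
  by (rule poly_eqI) (simp add: coeff_map_poly)

lemma of_int_poly_diff: "of_int_poly (p - q) = of_int_poly p - of_int_poly q"
  by (rule poly_eqI) (simp add: coeff_map_poly)

lemma of_int_poly_mult: "of_int_poly (p * q) = of_int_poly p * of_int_poly q"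
  by (rule poly_eqI) (simp add: coeff_map_poly coeff_mult)

lemma of_int_poly_smult: "of_int_poly (smult c p) = smult (of_int c) (of_int_poly p)"
  by (rule poly_eqI) (simp add: coeff_map_poly)

lemma of_int_poly_power: "of_int_poly (p ^ n) = of_int_poly p ^ n"
  by (induction n) (simp_all add: of_int_poly_mult)

lemma of_int_poly_monom: "of_int_poly (monom c n) = monom (of_int c) n"
  by (rule poly_eqI) (simp add: coeff_map_poly)

lemma of_int_poly_sum: "of_int_poly (sum f A) = (\<Sum>x\<in>A. of_int_poly (f x))"
  by (induction A rule: infinite_finite_induct) (simp_all add: of_int_poly_add)

lemma of_int_poly_prod: "of_int_poly (prod f A) = (\<Prod>x\<in>A. of_int_poly (f x))"
  by (induction A rule: infinite_finite_induct) (simp_all add: of_int_poly_mult)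

lemmas of_int_poly_hom = of_int_poly_add of_int_poly_diff of_int_poly_mult of_int_poly_smult
  of_int_poly_power of_int_poly_monom of_int_poly_sum of_int_poly_prod

lemma of_rat_of_int_poly:
  "map_poly of_rat (of_int_poly p) = (of_int_poly p :: 'a::field_char_0 poly)"
  by (rule poly_eqI) (simp add: coeff_map_poly)

lemma of_int_poly_of_real:
  "poly (of_int_poly p) (of_real x :: 'a::{real_algebra_1,field_char_0})
     = of_real (poly (of_int_poly p) x)"
  by (induction p) (auto simp: map_poly_pCons)

lemma complex_of_real_of_rat: "complex_of_real (of_rat r) = of_rat r"
  by (cases r) (simp add: of_rat_rat)

lemma of_rat_poly_of_real:
  "poly (map_poly of_rat p) (of_real x :: complex) = of_real (poly (map_poly of_rat p) x)"
  by (induction p) (auto simp: map_poly_pCons complex_of_real_of_rat)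

lemma degree_of_int_poly [simp]: "degree (of_int_poly p :: 'a::{comm_ring_1,ring_char_0} poly) = degree p"
  by (rule degree_map_poly) simp

lemma of_int_poly_eq_0_iff [simp]:
  "of_int_poly p = (0 :: 'a::{comm_ring_1,ring_char_0} poly) \<longleftrightarrow> p = 0"
  by (simp add: poly_eq_iff coeff_map_poly)

section \<open>The Frobenius congruence\<close>

lemma prime_dvd_add_power_diff:
  fixes x y :: "'a::comm_ring_1"
  assumes "prime p"
  shows "of_nat p dvd (x + y) ^ p - x ^ p - y ^ p"
proof -
  have p0: "p > 0" using assms by (simp add: prime_gt_0_nat)
  have "(x + y) ^ p = (\<Sum>k\<le>p. of_nat (p choose k) * x ^ k * y ^ (p - k))"
    by (rule binomial_ring)
  also have "{..p} = insert 0 (insert p {1..<p})"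
    using p0 by auto
  also have "(\<Sum>k\<in>\<dots>. of_nat (p choose k) * x ^ k * y ^ (p - k)) =
      y ^ p + (x ^ p + (\<Sum>k\<in>{1..<p}. of_nat (p choose k) * x ^ k * y ^ (p - k)))"
    using p0 by (subst sum.insert; simp)
  finally have "(x + y) ^ p - x ^ p - y ^ p
      = (\<Sum>k\<in>{1..<p}. of_nat (p choose k) * x ^ k * y ^ (p - k))"
    by simp
  also have "of_nat p dvd \<dots>"
  proof (rule dvd_sum)
    fix k assume k: "k \<in> {1..<p}"
    have "p dvd (p choose k)"
      by (rule dvd_choose_prime) (use k assms in auto)
    then have "(of_nat p :: 'a) dvd of_nat (p choose k)"
      by (auto elim!: dvdE)
    then show "(of_nat p :: 'a) dvd of_nat (p choose k) * x ^ k * y ^ (p - k)"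
      by (simp add: dvd_mult2)
  qed
  finally show ?thesis .
qed

lemma prime_dvd_power_diff_self:
  fixes a :: int
  assumes "prime p"
  shows "int p dvd a ^ p - a"
proof (induction a rule: int_induct[where k = 0])
  case base
  show ?case using assms by (simp add: prime_gt_0_nat zero_power)
next
  case (step1 i)
  have "int p dvd ((i + 1) ^ p - i ^ p - 1 ^ p) + (i ^ p - i)"
    by (intro dvd_add step1 prime_dvd_add_power_diff[where 'a = int, simplified] assms)
  then show ?case by (simp add: algebra_simps)
next
  case (step2 i)
  have "int p dvd (i ^ p - i) - (((i - 1) + 1) ^ p - (i - 1) ^ p - 1 ^ p)"
    by (intro dvd_diff step2 prime_dvd_add_power_diff[where 'a = int, simplified] assms)
  then show ?case by (simp add: algebra_simps)
qed

text \<open>Writing \<open>h = a + x * h'\<close>, the difference splits into three multiples of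
  \<open>p\<close>: Fermat's congruence for the constant \<open>a\<close>, \<open>x ^ p\<close>
  times the induction hypothesis, and the mixed binomial terms.\<close>

lemma Frobenius_congruence:
  fixes h :: "int poly"
  assumes "prime p"
  shows "of_nat p dvd pcompose h (monom 1 p) - h ^ p"
proof (induction h)
  case 0
  show ?case using assms by (simp add: prime_gt_0_nat zero_power)
next
  case (pCons a h)
  let ?X = "monom 1 1 :: int poly"
  have X: "pCons a h = [:a:] + ?X * h" "?X ^ p = monom 1 p"
    by (simp_all add: monom_altdef)
  have "int p dvd - (a ^ p - a)"
    using prime_dvd_power_diff_self[OF assms, of a] by (subst dvd_minus_iff)
  then obtain b where b: "a - a ^ p = int p * b" by auto
  have 1: "of_nat p dvd [:a:] - [:a:] ^ p"
  proof
    show "[:a:] - [:a:] ^ p = of_nat p * [:b:]"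
      using b by (simp add: of_nat_poly poly_const_pow)
  qed
  have 2: "of_nat p dvd monom 1 p * (pcompose h (monom 1 p) - h ^ p)"
    using pCons.IH by (rule dvd_mult)
  have 3: "of_nat p dvd ([:a:] + ?X * h) ^ p - [:a:] ^ p - (?X * h) ^ p"
    by (rule prime_dvd_add_power_diff[OF assms])
  have "pcompose (pCons a h) (monom 1 p) - pCons a h ^ p =
     ([:a:] - [:a:] ^ p) + monom 1 p * (pcompose h (monom 1 p) - h ^ p)
     - (([:a:] + ?X * h) ^ p - [:a:] ^ p - (?X * h) ^ p)"
    unfolding X(1)[symmetric] pcompose_pCons[of a h]
    by (simp add: power_mult_distrib X(2)[simplified] algebra_simps)
  then show ?case using 1 2 3 by (metis dvd_add dvd_diff)
qed

section \<open>Integer polynomials with all roots in the closed unit disc\<close>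

text \<open>Lagrange interpolation on \<open>Z\<close> writes each coefficient of \<open>Q\<close>
  as a linear combination of its values on \<open>Z\<close>, with weights depending only on
  \<open>Z\<close>. Small values thus force integer coefficients of absolute value below 1.\<close>

lemma int_poly_small_values_eq_0:
  fixes Z :: "complex set"
  assumes "finite Z"
  obtains \<epsilon> :: real where "\<epsilon> > 0"
    "\<And>Q :: int poly. degree Q < card Z \<Longrightarrow>
        (\<And>z. z \<in> Z \<Longrightarrow> norm (poly (of_int_poly Q) z) < \<epsilon>) \<Longrightarrow> Q = 0"
proof -
  define l where "l w = (\<Prod>v\<in>Z - {w}. smult (1 / (w - v)) [:- v, 1:])" for w :: complex
  have l: "poly (l w) v = (if v = w then 1 else 0)" if "w \<in> Z" "v \<in> Z" for v w
  proof (cases "v = w")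
    case True
    then have "poly (l w) v = (\<Prod>u\<in>Z - {w}. 1)"
      unfolding l_def poly_prod by (intro prod.cong) (auto simp: diff_divide_distrib[symmetric])
    with True show ?thesis by simp
  next
    case False
    then have "\<exists>u\<in>Z - {w}. poly (smult (1 / (w - u)) [:- u, 1:]) v = 0"
      using that by (intro bexI[of _ v]) auto
    with False show ?thesis unfolding l_def poly_prod using assms by (simp add: prod_zero_iff)
  qed
  have deg_l: "degree (l w) < card Z" if "w \<in> Z" for w
  proof -
    have "degree (l w) \<le> (\<Sum>v\<in>Z - {w}. 1)"
      unfolding l_def
    proof (rule order_trans[OF degree_prod_sum_le], use assms in simp, rule sum_mono)
      show "(degree \<circ> (\<lambda>v. smult (1 / (w - v)) [:- v, 1:])) v \<le> 1" for v
        unfolding o_def by (rule order_trans[OF degree_smult_le]) simp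
    qed
    also have "\<dots> = card (Z - {w})" by simp
    also have "\<dots> < card Z" using that assms by (rule card_Diff1_less[rotated])
    finally show ?thesis .
  qed
  \<comment> \<open>The summand 1 keeps \<open>B\<close> positive and makes the final bound on the
    coefficients strictly smaller than 1.\<close>
  define B where "B = 1 + (\<Sum>w\<in>Z. \<Sum>j<card Z. norm (coeff (l w) j))"
  have B: "B > 0" unfolding B_def by (intro add_pos_nonneg sum_nonneg) auto
  show thesis
  proof (rule that[of "1 / B"])
    show "1 / B > 0" using B by simp
    fix Q :: "int poly"
    assume deg: "degree Q < card Z"
      and small: "\<And>z. z \<in> Z \<Longrightarrow> norm (poly (of_int_poly Q) z) < 1 / B"
    define Q' :: "complex poly" where "Q' = of_int_poly Q"
    have "Q' = (\<Sum>w\<in>Z. smult (poly Q' w) (l w))"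
    proof (rule poly_eqI_degree[of Z])
      show "poly Q' v = poly (\<Sum>w\<in>Z. smult (poly Q' w) (l w)) v" if "v \<in> Z" for v
        using that assms by (simp add: poly_sum l if_distrib cong: if_cong)
      show "degree Q' < card Z" using deg by (simp add: Q'_def)
      show "degree (\<Sum>w\<in>Z. smult (poly Q' w) (l w)) < card Z"
        by (rule degree_sum_less) (use deg deg_l in \<open>auto intro: le_less_trans[OF degree_smult_le]\<close>)
    qed
    then have coeff_Q': "coeff Q' j = (\<Sum>w\<in>Z. poly Q' w * coeff (l w) j)" for j
      by (metis (no_types, lifting) coeff_smult coeff_sum sum.cong)
    have "coeff Q j = 0" for j
    proof (cases "j < card Z")
      case True
      have "norm (coeff Q' j) \<le> (\<Sum>w\<in>Z. norm (poly Q' w) * norm (coeff (l w) j))"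
        unfolding coeff_Q' norm_mult[symmetric] by (rule norm_sum)
      also have "\<dots> \<le> (\<Sum>w\<in>Z. 1 / B * norm (coeff (l w) j))"
        using small by (intro sum_mono mult_right_mono) (auto simp: Q'_def less_imp_le)
      also have "\<dots> = 1 / B * (\<Sum>w\<in>Z. norm (coeff (l w) j))"
        by (simp add: sum_distrib_left)
      also have "\<dots> < 1 / B * B"
      proof (rule mult_strict_left_mono)
        have "(\<Sum>w\<in>Z. norm (coeff (l w) j)) \<le> (\<Sum>w\<in>Z. \<Sum>j<card Z. norm (coeff (l w) j))"
          using True by (intro sum_mono member_le_sum) auto
        then show "(\<Sum>w\<in>Z. norm (coeff (l w) j)) < B" unfolding B_def by simp
      qed (use B in simp)
      finally have "\<bar>real_of_int (coeff Q j)\<bar> < 1"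
        using B by (simp add: Q'_def coeff_map_poly)
      then show ?thesis by linarith
    next
      case False
      then show ?thesis using deg by (simp add: coeff_eq_0)
    qed
    then show "Q = 0" by (simp add: poly_eq_iff)
  qed
qed

text \<open>Pseudo-division multiplies \<open>f\<close> by a power of the leading coefficient of
  \<open>g\<close>, which is 1 here, so it is honest division over the integers.\<close>

lemma monic_divide:
  fixes f g :: "int poly"
  assumes "lead_coeff g = 1" "degree g > 0"
  obtains q r where "f = g * q + r" "degree r < degree g"
proof -
  have g: "g \<noteq> 0" using assms by auto
  obtain q r where "pseudo_divmod f g = (q, r)" by force
  from pseudo_divmod[OF g this] assms have "f = g * q + r" "degree r < degree g"
    by auto
  then show thesis by (rule that)
qed

text \<open>At a root \<open>w\<close> the Frobenius congruence gives
  \<open>h(w ^ p) = p * r(w)\<close>, where \<open>r\<close> is the remainder of the integral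
  quotient modulo \<open>h\<close>. As \<open>w ^ p\<close> stays in the disc, the left side is
  bounded independently of \<open>p\<close>, so \<open>r(w)\<close> is tiny for large
  \<open>p\<close>. Distinctness of the roots, \<open>card Z = degree h\<close>, lets interpolation
  conclude \<open>r = 0\<close>.\<close>

lemma roots_closed_under_large_prime_powers:
  fixes h :: "int poly"
  defines "Z \<equiv> {z::complex. poly (of_int_poly h) z = 0}"
  assumes monic: "lead_coeff h = 1" and deg: "degree h > 0" and card: "card Z = degree h"
    and disc: "\<And>z. z \<in> Z \<Longrightarrow> norm z \<le> 1"
  obtains N :: nat where "\<And>p z. prime p \<Longrightarrow> p > N \<Longrightarrow> z \<in> Z \<Longrightarrow> z ^ p \<in> Z"
proof -
  have fin: "finite Z" using card deg by (metis card.infinite less_irrefl)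
  obtain \<epsilon> :: real where \<epsilon>: "\<epsilon> > 0"
    and zero: "\<And>Q :: int poly. degree Q < card Z \<Longrightarrow>
        (\<And>z. z \<in> Z \<Longrightarrow> norm (poly (of_int_poly Q) z) < \<epsilon>) \<Longrightarrow> Q = 0"
    using int_poly_small_values_eq_0[OF fin] by metis
  define B where "B = (\<Sum>i\<le>degree h. \<bar>real_of_int (coeff h i)\<bar>)"
  have bound: "norm (poly (of_int_poly h) z) \<le> B" if "norm z \<le> 1" for z :: complex
  proof -
    have "norm (poly (of_int_poly h) z) \<le> (\<Sum>i\<le>degree h. norm (of_int (coeff h i) * z ^ i))"
      by (simp add: poly_altdef coeff_map_poly norm_sum)
    also have "\<dots> \<le> B" unfolding B_def
      using that by (intro sum_mono) (auto simp: norm_mult norm_power power_le_one mult_left_le)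
    finally show ?thesis .
  qed
  obtain N :: nat where N: "real N > B / \<epsilon>" using reals_Archimedean2 by blast
  show thesis
  proof (rule that[of N])
    fix p z assume p: "prime p" "p > N" and z: "z \<in> Z"
    obtain G where G: "pcompose h (monom 1 p) - h ^ p = of_nat p * G"
      using Frobenius_congruence[OF p(1), of h] by (auto elim: dvdE)
    obtain q r where qr: "G = h * q + r" "degree r < degree h"
      using monic_divide[OF monic deg] .
    have eval: "poly (of_int_poly h) (w ^ p) = of_nat p * poly (of_int_poly r) w"
      if "w \<in> Z" for w
    proof -
      have "pcompose h (monom 1 p) = h ^ p + smult (int p) (h * q + r)"
        using G qr by (simp add: of_nat_poly smult_add_right algebra_simps)
      moreover have "of_int_poly (pcompose h (monom 1 p)) = pcompose (of_int_poly h) (monom 1 p :: complex poly)"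
        by (induction h) (simp_all add: pcompose_pCons map_poly_pCons of_int_poly_hom)
      ultimately have "poly (pcompose (of_int_poly h) (monom 1 p)) w
          = poly (of_int_poly (h ^ p + smult (int p) (h * q + r))) w" by metis
      then show ?thesis using that prime_gt_0_nat[OF p(1)]
        by (simp add: poly_pcompose poly_monom of_int_poly_hom Z_def)
    qed
    have p0: "real p > 0" using p(1) by (simp add: prime_gt_0_nat)
    have "r = 0"
    proof (rule zero)
      show "degree r < card Z" using qr card by simp
      fix w assume w: "w \<in> Z"
      have "real p * norm (poly (of_int_poly r) w) \<le> B"
        using bound[of "w ^ p"] disc[OF w] by (simp add: eval[OF w] norm_mult norm_power power_le_one)
      moreover have "B < \<epsilon> * real p"
        using N p(2) \<epsilon> by (simp add: field_simps) (smt (verit) mult_less_cancel_left_pos of_nat_less_iff)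
      ultimately show "norm (poly (of_int_poly r) w) < \<epsilon>"
        using p0 by (smt (verit) mult.commute mult_less_cancel_left_pos)
    qed
    then show "z ^ p \<in> Z" using eval[OF z] by (simp add: Z_def)
  qed
qed

section \<open>Primitive roots of unity among the zeros\<close>

lemma root_of_unity_eq_cis:
  fixes z :: complex
  assumes "z ^ m = 1" "m > 0"
  obtains n k :: nat where "n > 0" "coprime k n" "z = cis (2 * pi * real k / real n)"
proof -
  obtain j where j: "z = cis (2 * pi * real j / real m)"
    using Complex.bij_betw_roots_unity[OF assms(2)] assms(1)
    by (auto simp: bij_betw_def image_iff)
  define g where "g = gcd j m"
  have g: "g > 0" using assms(2) by (simp add: g_def)
  have "coprime (j div g) (m div g)" unfolding g_def using assms(2) by (intro div_gcd_coprime) auto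
  moreover have "m div g > 0" using assms(2) g unfolding g_def by (simp add: div_greater_zero_iff)
  moreover have "real j / real m = real (j div g) / real (m div g)"
    using g by (simp add: g_def real_of_nat_div)
  then have "z = cis (2 * pi * real (j div g) / real (m div g))"
    unfolding j by (simp add: times_divide_eq_right[symmetric] del: times_divide_eq_right)
  ultimately show thesis by (intro that)
qed

text \<open>Let \<open>t\<close> be the product of the primes up to \<open>N\<close> not dividing
  \<open>j\<close>, and take \<open>j + n * t\<close>. Each prime up to \<open>N\<close> divides
  exactly one of the two summands: one that divides \<open>j\<close> divides neither
  \<open>n\<close>, by coprimality, nor \<open>t\<close>.\<close>

lemma ex_cong_large_prime_factors:
  fixes j n N :: nat
  assumes "coprime j n" "n > 0"
  obtains j' where "[j' = j] (mod n)" "j' > 0" "\<And>q. prime q \<Longrightarrow> q dvd j' \<Longrightarrow> q > N"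
proof -
  define t where "t = \<Prod>{q. prime q \<and> q \<le> N \<and> \<not> q dvd j}"
  have fin: "finite {q. prime q \<and> q \<le> N \<and> \<not> q dvd j}" by simp
  have t0: "t > 0" unfolding t_def by (intro prod_pos) (auto simp: prime_gt_0_nat)
  show thesis
  proof (cases "j + n * t > 0")
    case True
    show thesis
    proof (rule that[of "j + n * t"])
      show "[j + n * t = j] (mod n)" by (simp add: cong_def)
      fix q assume q: "prime q" "q dvd j + n * t"
      show "q > N"
      proof (rule ccontr)
        assume "\<not> q > N"
        then have qN: "q \<le> N" by simp
        show False
        proof (cases "q dvd j")
          case True
          then have "q dvd n * t" using q(2) by (simp add: dvd_add_right_iff)
          moreover have "\<not> q dvd n" using True assms(1) q(1)
            by (meson coprime_common_divisor not_prime_unit)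
          ultimately have "q dvd t" using q(1) by (simp add: prime_dvd_mult_iff)
          then obtain q' where q': "prime q'" "\<not> q' dvd j" "q dvd q'"
            unfolding t_def using q(1) fin by (auto simp: prime_dvd_prod_iff)
          then show False using True q(1) by (metis primes_dvd_imp_eq)
        next
          case False
          then have "q dvd t" unfolding t_def using q(1) qN by (intro dvd_prodI[OF fin]) auto
          then show False using False q(2) by (simp add: dvd_add_left_iff)
        qed
      qed
    qed (use True in simp)
  qed (use t0 assms(2) in simp)
qed

text \<open>Repeated \<open>p\<close>-th powers of a zero, for one large prime \<open>p\<close>,
  stay in the finite set \<open>Z\<close> and must repeat, so the zero is a root of unity
  \<open>cis (2 * pi * k / n)\<close>. An inverse of \<open>k\<close> modulo \<open>n\<close> with
  only large prime factors is an exponent that stays in \<open>Z\<close> and leads to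
  \<open>cis (2 * pi / n)\<close>.\<close>

lemma ex_primitive_root_of_unity_root:
  fixes h :: "int poly"
  defines "Z \<equiv> {z::complex. poly (of_int_poly h) z = 0}"
  assumes monic: "lead_coeff h = 1" and deg: "degree h > 0" and card: "card Z = degree h"
    and disc: "\<And>z. z \<in> Z \<Longrightarrow> norm z \<le> 1" and nz: "0 \<notin> Z"
  obtains n :: nat where "n > 0" "cis (2 * pi / real n) \<in> Z"
proof -
  have fin: "finite Z" and ne: "Z \<noteq> {}" using card deg by (auto intro: card_ge_0_finite)
  obtain N :: nat where N: "\<And>p z. prime p \<Longrightarrow> p > N \<Longrightarrow> z \<in> Z \<Longrightarrow> z ^ p \<in> Z"
    using roots_closed_under_large_prime_powers[of h] monic deg card disc unfolding Z_def by blast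
  have powers: "z ^ m \<in> Z" if "m > 0" "\<And>q. prime q \<Longrightarrow> q dvd m \<Longrightarrow> q > N" "z \<in> Z" for m z
    using that
  proof (induction m arbitrary: z rule: prime_divisors_induct)
    case (factor p m)
    have "z ^ p \<in> Z" using factor.prems factor.hyps by (intro N) auto
    then have "(z ^ p) ^ m \<in> Z" using factor.prems by (intro factor.IH) auto
    then show ?case by (simp add: power_mult)
  qed auto
  obtain z where z: "z \<in> Z" using ne by auto
  obtain p where p: "prime p" "p > N" using bigger_prime by blast
  have "z ^ (p ^ i) \<in> Z" for i
    using p z by (intro powers) (auto simp: prime_gt_0_nat dest: prime_dvd_power primes_dvd_imp_eq)
  then have "\<not> inj (\<lambda>i. z ^ (p ^ i))"
    using fin by (metis finite_imageD finite_subset image_subsetI infinite_UNIV_nat)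
  then obtain i j where ij: "i < j" "z ^ (p ^ i) = z ^ (p ^ j)"
    by (metis injI linorder_neqE_nat)
  \<comment> \<open>The repetition becomes a positive power of \<open>z\<close> equal to 1 by
    cancelling \<open>z ^ (p ^ i)\<close>, which is legitimate because 0 is not in
    \<open>Z\<close>.\<close>
  have "p ^ i < p ^ j" using ij(1) prime_gt_1_nat[OF p(1)] by (rule power_strict_increasing)
  moreover have "z ^ (p ^ j) = z ^ (p ^ i) * z ^ (p ^ j - p ^ i)"
    using calculation by (simp flip: power_add)
  ultimately have "z ^ (p ^ j - p ^ i) = 1" "p ^ j - p ^ i > 0"
    using ij(2) z nz by auto
  then obtain n k :: nat where n: "n > 0" and k: "coprime k n" "z = cis (2 * pi * real k / real n)"
    by (rule root_of_unity_eq_cis)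
  obtain j where j: "[k * j = 1] (mod n)"
    using cong_solve_coprime_nat[OF k(1)] by auto
  then have "[j * k = Suc 0] (mod n)" by (simp add: mult.commute)
  then have "coprime j n" using n by (auto simp: coprime_iff_invertible_nat)
  then obtain j' where j': "[j' = j] (mod n)" "j' > 0" "\<And>q. prime q \<Longrightarrow> q dvd j' \<Longrightarrow> q > N"
    using ex_cong_large_prime_factors n by metis
  have "[k * j' = 1] (mod n)" using j j'(1) by (metis cong_scalar_left cong_trans)
  then obtain s t where "1 + s * n = k * j' + t * n" unfolding cong_iff_lin_nat by blast
  then have st: "k * j' + n * t = 1 + n * s" by (simp add: mult.commute)
  have kj: "real k * real j' = 1 + real n * (real s - real t)"
    using arg_cong[OF st, of real] by (simp add: right_diff_distrib)
  have "2 * pi * real k / real n * real j' = 2 * pi / real n * (real k * real j')" by simp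
  also have "\<dots> = 2 * pi / real n + 2 * pi * (real s - real t)"
    using n unfolding kj by (simp add: distrib_left)
  finally have "2 * pi * real k / real n * real j' + 2 * pi * real t = 2 * pi / real n + 2 * pi * real s"
    by (simp add: right_diff_distrib)
  then have "cis (2 * pi * real k / real n * real j') * cis (2 * pi * real t)
      = cis (2 * pi / real n) * cis (2 * pi * real s)"
    by (simp only: cis_mult)
  moreover have "cis (2 * pi * real t) = 1" "cis (2 * pi * real s) = 1"
    by (simp_all add: cis_multiple_2pi)
  ultimately have "cis (2 * pi * real k / real n * real j') = cis (2 * pi / real n)"
    by simp
  then have "cis (2 * pi / real n) = z ^ j'"
    unfolding k(2) Complex.DeMoivre by (simp add: mult.commute)
  then have "cis (2 * pi / real n) \<in> Z" using powers[of j' z] j' z by simp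
  then show thesis using n that by blast
qed

section \<open>Integrality of monic factors\<close>

lemma ex_int_multiple:
  fixes p :: "rat poly"
  obtains c :: int and q :: "int poly" where "c > 0" "smult (of_int c) p = of_int_poly q"
proof -
  have "\<exists>c::int. c > 0 \<and> (\<exists>q. smult (of_int c) p = (of_int_poly q :: rat poly))"
  proof (induction p)
    case 0
    show ?case by (intro exI[of _ 1] conjI exI[of _ 0]) auto
  next
    case (pCons a p)
    then obtain c q where cq: "c > 0" "smult (of_int c) p = (of_int_poly q :: rat poly)" by blast
    obtain m d where md: "a = of_int m / of_int d" "d > 0"
      by (metis quotient_of_denom_pos quotient_of_div surj_pair)
    have "smult (of_int (c * d)) (pCons a p) = (of_int_poly (pCons (c * m) (smult d q)) :: rat poly)"
      using md cq(2) by (simp add: map_poly_pCons of_int_poly_smult flip: cq(2))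
        (simp add: mult.commute)
    then show ?case using md(2) cq(1) by (metis mult_pos_pos)
  qed
  then show thesis using that by blast
qed

text \<open>Gauss's lemma. Clearing denominators gives \<open>A = c * p\<close> and
  \<open>B = d * q\<close> with leading coefficients \<open>c\<close> and \<open>d\<close>. The
  contents divide these and multiply to \<open>c * d\<close>, since the monic \<open>P\<close> has
  content 1; so \<open>content A = c\<close>, and \<open>p\<close> is the primitive part of
  \<open>A\<close>.\<close>

lemma monic_factor_integral:
  fixes P :: "int poly" and p q :: "rat poly"
  assumes P: "lead_coeff P = 1" and eq: "of_int_poly P = p * q" and p: "lead_coeff p = 1"
  obtains h :: "int poly" where "p = of_int_poly h" "lead_coeff h = 1"
proof -
  obtain c A where A: "c > 0" "smult (of_int c) p = of_int_poly A" by (rule ex_int_multiple)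
  obtain d B where B: "d > 0" "smult (of_int d) q = of_int_poly B" by (rule ex_int_multiple)
  have "of_int_poly (A * B) = (of_int_poly (smult (c * d) P) :: rat poly)"
    by (simp add: of_int_poly_mult of_int_poly_smult eq mult.commute flip: A(2) B(2))
  then have AB: "A * B = smult (c * d) P"
    by (simp add: poly_eq_iff coeff_map_poly flip: of_int_mult)
  have "content P dvd 1" using content_dvd_coeff[of P "degree P"] P by simp
  then have "content P = 1" by (simp only: is_unit_content_iff)
  then have cont: "content A * content B = c * d"
    using arg_cong[OF AB, of content] A(1) B(1) by (simp add: content_mult abs_mult)
  have lcA: "lead_coeff A = c"
  proof -
    have "degree A = degree p" using A by (metis degree_of_int_poly degree_smult_eq of_int_eq_0_iff less_irrefl)
    then have "rat_of_int (lead_coeff A) = of_int c"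
      using arg_cong[OF A(2), of "\<lambda>x. coeff x (degree p)"] p by (simp add: coeff_map_poly)
    then show ?thesis by simp
  qed
  have lcB: "lead_coeff B = d"
    using arg_cong[OF AB, of lead_coeff] lcA P A(1) by (simp add: lead_coeff_mult)
  have "content A dvd c" "content B dvd d" using lcA lcB content_dvd_coeff by metis+
  then obtain e f where ef: "c = content A * e" "d = content B * f" by (auto elim!: dvdE)
  have "content A * content B * (e * f) = content A * content B * 1" using cont ef by (simp add: mult_ac)
  then have "e * f = 1" using cont A(1) B(1) by (metis mult_cancel_left mult_pos_pos less_irrefl)
  moreover have "content A \<ge> 0" using normalize_content[of A] by (simp only: normalize_int_def)
  then have "e > 0" using ef(1) A(1) by (simp add: zero_less_mult_iff)
  ultimately have "e = 1" by (simp add: pos_zmult_eq_1_iff)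
  then have c: "content A = c" using ef by simp
  then have "smult (of_int c) p = smult (of_int c) (of_int_poly (primitive_part A) :: rat poly)"
    by (metis A(2) content_times_primitive_part of_int_poly_smult)
  then have "p = of_int_poly (primitive_part A)"
    using A(1) by (simp add: poly_eq_iff)
  moreover have "lead_coeff (primitive_part A) = 1"
    using content_times_primitive_part[of A] lcA A(1) c
    by (metis lead_coeff_smult less_irrefl mult_cancel_left mult.right_neutral)
  ultimately show thesis by (rule that)
qed

section \<open>Cotangent estimates\<close>

text \<open>As long as the total angle stays below \<open>pi / 2\<close>, the denominator in the
  addition formula lies between 0 and 1, so tangent is superadditive.\<close>

lemma tan_multiple_ge:
  fixes x :: real
  assumes "0 < x" "real M * x < pi / 2" "M > 0"
  shows "real M * tan x \<le> tan (real M * x)"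
  using assms(3,2)
proof (induction M rule: nat_induct_non_zero)
  case (Suc n)
  have lt: "real n * x + x < pi / 2" using Suc.prems by (simp add: algebra_simps)
  have xn: "real n * x > 0" using Suc.hyps assms(1) by simp
  have t: "tan (real n * x) > 0" "tan x > 0"
    using xn lt assms(1) by (auto intro!: tan_gt_zero)
  have c: "cos (real n * x) > 0" "cos x > 0" "cos (real n * x + x) > 0"
    using xn lt assms(1) by (auto intro!: cos_gt_zero_pi)
  have d: "1 - tan (real n * x) * tan x > 0"
  proof -
    have "1 - tan (real n * x) * tan x = cos (real n * x + x) / (cos (real n * x) * cos x)"
      using c by (simp add: tan_def cos_add field_simps)
    then show ?thesis using c by simp
  qed
  have "real (Suc n) * tan x \<le> tan (real n * x) + tan x"
    using Suc.IH lt assms(1) by (simp add: algebra_simps)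
  also have "\<dots> \<le> (tan (real n * x) + tan x) / (1 - tan (real n * x) * tan x)"
    using d t by (simp add: pos_le_divide_eq mult_le_cancel_left1)
  also have "\<dots> = tan (real (Suc n) * x)"
    using tan_add[of "real n * x" x] c by (simp add: algebra_simps)
  finally show ?case .
qed simp

lemma cot_multiple_le:
  fixes x :: real
  assumes "0 < x" "real M * x < pi / 2" "M > 0"
  shows "cot (real M * x) \<le> cot x / real M"
proof -
  have "1 * x \<le> real M * x" using assms by (intro mult_right_mono) auto
  then have "x < pi / 2" using assms(2) by linarith
  then have "tan x > 0" using assms(1) by (rule tan_gt_zero[rotated])
  moreover have "real M * tan x \<le> tan (real M * x)" by (rule tan_multiple_ge[OF assms])
  ultimately have "inverse (tan (real M * x)) \<le> inverse (real M * tan x)"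
    using assms(3) by (intro le_imp_inverse_le) auto
  then show ?thesis by (simp add: cot_altdef field_simps)
qed

lemma cot_antimono:
  fixes x y :: real
  assumes "0 < x" "x \<le> y" "y < pi"
  shows "cot y \<le> cot x"
proof -
  have "sin x > 0" "sin y > 0" "sin (y - x) \<ge> 0" using assms by (auto intro: sin_gt_zero sin_ge_zero)
  then show ?thesis by (simp add: cot_def sin_diff field_simps)
qed

lemma cot_nonneg:
  fixes x :: real
  assumes "0 < x" "x \<le> pi / 2"
  shows "cot x \<ge> 0"
  using assms by (auto simp: cot_def intro!: divide_nonneg_nonneg cos_ge_zero sin_ge_zero)

lemma cot_pi_minus: "cot (pi - x) = - cot (x :: real)"
  by (simp add: cot_def)

lemma cot_mod_eq:
  fixes a n :: nat
  assumes "n > 0"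
  shows "cot (pi * real a / real n) = cot (pi * real (a mod n) / real n)"
proof -
  have "real a = real (a mod n) + real n * real (a div n)"
    by (metis mod_mult_div_eq of_nat_add of_nat_mult)
  then have "pi * real a / real n = pi * real (a mod n) / real n + real (a div n) * pi"
    using assms by (simp add: field_simps)
  then show ?thesis by (simp add: cot_def sin_add cos_add)
qed

text \<open>Cotangent decreases between 0 and \<open>pi\<close>, so the worst residue of
  \<open>a\<close> modulo \<open>n\<close> is \<open>n - 1\<close>.\<close>

lemma cot_ge_minus:
  fixes a n :: nat
  assumes "n > 0" "\<not> n dvd a"
  shows "cot (pi * real a / real n) \<ge> - cot (pi / real n)"
proof -
  define r where "r = a mod n"
  have r: "r > 0" "r < n" using assms by (auto simp: r_def dvd_eq_mod_eq_0)
  have "pi * real r \<le> pi * (real n - 1)" using r by (intro mult_left_mono) auto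
  then have "pi * real r / real n \<le> pi - pi / real n" using assms(1) by (simp add: field_simps)
  then have "cot (pi - pi / real n) \<le> cot (pi * real r / real n)"
    using r by (intro cot_antimono) (auto simp: field_simps)
  then show ?thesis using assms(1) by (simp add: cot_pi_minus cot_mod_eq[of n a] r_def)
qed

text \<open>A negative value needs a residue \<open>n - s\<close> with \<open>0 < s < n / 2\<close>,
  and \<open>far\<close> then forces \<open>s \<ge> 2 * M\<close>. The angle
  \<open>pi * s / n\<close> is therefore at least \<open>M\<close> times \<open>2 * pi / n\<close>,
  which gains the factor \<open>1 / M\<close>.\<close>

lemma cot_ge_minus_small:
  fixes a n M :: nat
  assumes n: "n \<ge> 4" "\<not> n dvd a" and M: "M > 0"
    and far: "\<And>s. 1 \<le> s \<Longrightarrow> s < 2 * M \<Longrightarrow> 2 * s < n \<Longrightarrow> \<not> n dvd a + s"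
  shows "cot (pi * real a / real n) \<ge> - (cot (2 * pi / real n) / real M)"
proof -
  define r where "r = a mod n"
  have r: "r > 0" "r < n" using n by (auto simp: r_def dvd_eq_mod_eq_0)
  have c2: "cot (2 * pi / real n) \<ge> 0" using n by (intro cot_nonneg) (auto simp: field_simps)
  have "cot (pi * real r / real n) \<ge> - (cot (2 * pi / real n) / real M)"
  proof (cases "2 * r \<le> n")
    case True
    have "real r * 2 \<le> real n" using True by simp
    then have "pi * (real r * 2) \<le> pi * real n" by (intro mult_left_mono) auto
    then have "cot (pi * real r / real n) \<ge> 0"
      using r n by (intro cot_nonneg) (auto simp: field_simps)
    then show ?thesis using c2 by (smt (verit) divide_nonneg_nonneg of_nat_0_le_iff)
  next
    case False
    define s where "s = n - r"
    have s: "1 \<le> s" "2 * s < n" using r False by (auto simp: s_def)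
    have "n dvd a + s"
    proof -
      have "a = n * (a div n) + r" by (simp add: r_def)
      then have "a + s = n * (a div n) + n" using r by (simp add: s_def)
      then show ?thesis by simp
    qed
    then have sM: "s \<ge> 2 * M" using far s by force
    have "pi * real r / real n = pi - pi * real s / real n"
      using r by (simp add: s_def of_nat_diff field_simps)
    then have "cot (pi * real r / real n) = - cot (pi * real s / real n)" by (simp add: cot_pi_minus)
    moreover have "cot (pi * real s / real n) \<le> cot (real M * (2 * pi / real n))"
    proof (rule cot_antimono)
      show "0 < real M * (2 * pi / real n)" using M n by simp
      have "pi * (2 * real M) \<le> pi * real s" using sM by (intro mult_left_mono) auto
      then show "real M * (2 * pi / real n) \<le> pi * real s / real n"
        using n by (simp add: field_simps)
      show "pi * real s / real n < pi" using s n by (simp add: field_simps)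
    qed
    moreover have "cot (real M * (2 * pi / real n)) \<le> cot (2 * pi / real n) / real M"
    proof (rule cot_multiple_le)
      have "4 * real M < real n" using sM s by linarith
      then have "pi * (4 * real M) < pi * real n" by (intro mult_strict_left_mono) auto
      then show "real M * (2 * pi / real n) < pi / 2" using n by (simp add: field_simps)
    qed (use M n in auto)
    ultimately show ?thesis by linarith
  qed
  then show ?thesis using n by (simp add: cot_mod_eq[of n a] r_def)
qed

text \<open>With \<open>r = 0\<close>, \<open>a_cong\<close> makes the exponents pairwise coprime;
  with larger \<open>r\<close>, an \<open>a i\<close> congruent to \<open>- r\<close> modulo
  \<open>n\<close> forces all later exponents to be 1 modulo \<open>n\<close>. The bound
  \<open>4 * m - 4\<close> is twice the number of indices from 2 on.\<close>

locale cotangent_family =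
  fixes a :: "nat \<Rightarrow> nat" and m :: nat
  assumes m2: "m \<ge> 2"
    and a0: "a 0 = 1" and a1: "a 1 = 2" and a_gt1: "\<And>i. 0 < i \<Longrightarrow> i < 2 * m \<Longrightarrow> a i > 1"
    and a_cong: "\<And>i j r. i < j \<Longrightarrow> 2 \<le> j \<Longrightarrow> j < 2 * m \<Longrightarrow> r < 4 * m - 4 \<Longrightarrow> a i + r dvd a j - 1"
begin

lemma a_gt0: "i < 2 * m \<Longrightarrow> a i > 0"
  using a0 a_gt1[of i] by (cases "i = 0") auto

text \<open>From \<open>n dvd a i + s\<close> and \<open>a i + s dvd a j - 1\<close> it follows that
  \<open>a j\<close> is 1 modulo \<open>n\<close>. Then \<open>n\<close> divides
  \<open>t + 1\<close>, which is too small for that.\<close>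

lemma at_most_one_close:
  assumes "n \<ge> 3" "i < j" "2 \<le> j" "j < 2 * m" "s < 4 * m - 4" "n dvd a i + s" "n dvd a j + t" "2 * t < n"
  shows False
proof -
  have "n dvd a j - 1" using assms a_cong dvd_trans by blast
  then have "n dvd (a j + t) - (a j - 1)" using assms(7) by (rule dvd_diff_nat[rotated])
  also have "(a j + t) - (a j - 1) = t + 1" using a_gt0[OF assms(4)] by simp
  finally have "n \<le> t + 1" by (rule dvd_imp_le) simp
  then show False using assms(1,8) by linarith
qed

text \<open>For \<open>n \<ge> 4\<close>, the \<open>M = 2 * m - 2\<close> terms from index 2 on
  lose at most \<open>cot (2 * pi / n) / M\<close> each, paid for by the term of \<open>a 1\<close>.
  At most one of them loses a further \<open>cot (pi / n)\<close>, paid for by the term of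
  \<open>a 0\<close>. The sine makes the inequality strict.\<close>

lemma cot_sum_pos:
  assumes n: "n \<ge> 3" and nd: "\<And>i. i < 2 * m \<Longrightarrow> \<not> n dvd a i"
  shows "4 * sin (2 * pi / real n) + (\<Sum>i<2*m. cot (pi * real (a i) / real n)) > 0"
proof -
  define e where "e i = cot (pi * real (a i) / real n)" for i
  have sin: "sin (2 * pi / real n) > 0" using n by (intro sin_gt_zero) (auto simp: field_simps)
  have split: "(\<Sum>i<2*m. e i) = e 0 + e 1 + (\<Sum>i\<in>{2..<2*m}. e i)"
  proof -
    have "{..<2*m} = insert 0 (insert 1 {2..<2*m})" using m2 by auto
    then show ?thesis by simp
  qed
  have e0: "e 0 = cot (pi / real n)" by (simp add: e_def a0)
  have e1: "e 1 = cot (2 * pi / real n)" by (simp add: e_def a1[simplified] mult.commute)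
  have c1: "cot (pi / real n) \<ge> 0" using n by (intro cot_nonneg) (auto simp: field_simps)
  have "(\<Sum>i<2*m. e i) \<ge> 0"
  proof (cases "n = 3")
    case True
    \<comment> \<open>For \<open>n = 3\<close> the term of \<open>a 1\<close> is itself negative,
      but it cancels that of \<open>a 0\<close>, and all other exponents are 1 modulo 3.\<close>
    have "e i = cot (pi / real n)" if i: "i \<in> {2..<2*m}" for i
    proof -
      have "a 1 + 1 dvd a i - 1" using i m2 by (intro a_cong) auto
      then have "3 dvd a i - 1" by (simp add: a1[simplified])
      moreover have "a i > 0" using a_gt0[of i] i by simp
      ultimately have "a i mod 3 = 1" by presburger
      then show ?thesis using True cot_mod_eq[of 3 "a i"] by (simp add: e_def)
    qed
    then have "(\<Sum>i\<in>{2..<2*m}. e i) \<ge> 0" using c1 by (intro sum_nonneg) auto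
    moreover have "cot (2 * pi / real n) = - cot (pi / real n)"
    proof -
      have "2 * pi / real n = pi - pi / real n" using True by simp
      then show ?thesis by (simp only: cot_pi_minus)
    qed
    ultimately show ?thesis unfolding split e0 e1 by simp
  next
    case False
    then have n4: "n \<ge> 4" using n by simp
    define M where "M = 2 * m - 2"
    have M: "M > 0" "2 * M = 4 * m - 4" using m2 by (auto simp: M_def)
    define B where "B = {i\<in>{2..<2*m}. \<exists>s. 1 \<le> s \<and> s < 2 * M \<and> 2 * s < n \<and> n dvd a i + s}"
    have finB: "finite B" by (simp add: B_def)
    have cB: "card B \<le> 1"
    proof (rule ccontr)
      assume "\<not> card B \<le> 1"
      then obtain i j where ij: "i \<in> B" "j \<in> B" "i < j"
        by (metis finB card_le_Suc0_iff_eq One_nat_def linorder_neqE_nat)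
      then show False using at_most_one_close[OF n ij(3)] M(2) unfolding B_def by auto
    qed
    define c where "c = cot (2 * pi / real n) / real M"
    have c: "c \<ge> 0" using n4 M unfolding c_def by (intro divide_nonneg_nonneg cot_nonneg) (auto simp: field_simps)
    \<comment> \<open>Charging \<open>c\<close> to every index, also to those in \<open>B\<close>,
      makes the total charge exactly \<open>M * c\<close>.\<close>
    have "e i \<ge> - (if i \<in> B then cot (pi / real n) else 0) - c" if i: "i \<in> {2..<2*m}" for i
    proof (cases "i \<in> B")
      case True
      then show ?thesis using cot_ge_minus[of n "a i"] nd[of i] i n c by (auto simp: e_def)
    next
      case False
      then have "e i \<ge> - c" unfolding e_def c_def using i M n4
        by (intro cot_ge_minus_small nd) (auto simp: B_def)
      then show ?thesis using False by simp
    qed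
    then have "(\<Sum>i\<in>{2..<2*m}. - (if i \<in> B then cot (pi / real n) else 0) - c) \<le> (\<Sum>i\<in>{2..<2*m}. e i)"
      by (intro sum_mono) auto
    also have "(\<Sum>i\<in>{2..<2*m}. - (if i \<in> B then cot (pi / real n) else 0) - c)
        = - (real (card B) * cot (pi / real n)) - real M * c"
    proof -
      have "{2..<2*m} \<inter> {i. i \<in> B} = B" by (auto simp: B_def)
      then show ?thesis by (simp add: sum_subtractf sum_negf sum.If_cases M_def)
    qed
    also have "real M * c = cot (2 * pi / real n)" using M by (simp add: c_def)
    finally have "(\<Sum>i\<in>{2..<2*m}. e i) \<ge> - (real (card B) * cot (pi / real n)) - cot (2 * pi / real n)" .
    moreover have "real (card B) * cot (pi / real n) \<le> 1 * cot (pi / real n)"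
      using cB c1 by (intro mult_right_mono) auto
    ultimately show ?thesis unfolding split e0 e1 by linarith
  qed
  then show ?thesis using sin by (simp add: e_def)
qed

end

section \<open>The polynomial\<close>

text \<open>Vieta's formula for the second coefficient, by adding one linear factor at a time. It
  carries traces between factors, products and coefficients.\<close>

lemma coeff_monic_eq_neg_sum_roots:
  fixes p :: "complex poly"
  assumes "lead_coeff p = 1" "degree p > 0"
  shows "coeff p (degree p - 1) = - \<Sum>\<^sub># (proots p)"
proof -
  have *: "degree (\<Prod>x\<in>#M. [:-x, 1:]) = size M \<and> coeff (\<Prod>x\<in>#M. [:-x, 1:]) (size M) = 1 \<and>
      (M \<noteq> {#} \<longrightarrow> coeff (\<Prod>x\<in>#M. [:-x, 1:]) (size M - 1) = - \<Sum>\<^sub># M)" for M :: "complex multiset"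
  proof (induction M)
    case (add z M)
    let ?q = "\<Prod>x\<in>#M. [:-x, 1:]"
    have "?q \<noteq> 0" using add.IH by auto
    then have "degree ([:-z, 1:] * ?q) = Suc (size M)" using add.IH by (subst degree_mult_eq) auto
    moreover have "coeff ([:-z, 1:] * ?q) (Suc (size M)) = 1"
      using add.IH by (simp add: coeff_eq_0)
    moreover have "coeff ([:-z, 1:] * ?q) (size M) = - (z + \<Sum>\<^sub># M)"
      using add.IH by (cases "size M") auto
    ultimately show ?case by simp
  qed simp
  have p: "(\<Prod>x\<in>#proots p. [:-x, 1:]) = p"
    using complex_poly_decompose_multiset[of p] assms by simp
  have "proots p \<noteq> {#}" using assms size_proots_complex[of p] by force
  then show ?thesis using *[of "proots p"] by (simp add: p size_proots_complex)
qed

lemma sum_mset_of_sum: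
  fixes f :: "'b \<Rightarrow> 'a::comm_monoid_add multiset"
  shows "\<Sum>\<^sub># (\<Sum>i\<in>A. f i) = (\<Sum>i\<in>A. \<Sum>\<^sub># (f i))"
  by (induction A rule: infinite_finite_induct) simp_all

definition geom_poly :: "nat \<Rightarrow> int poly" where
  "geom_poly n = (\<Sum>j<n. monom 1 j)"

lemma coeff_geom_poly: "coeff (geom_poly n) i = (if i < n then 1 else 0)"
  by (auto simp: geom_poly_def coeff_sum)

lemma geom_poly_1 [simp]: "geom_poly (Suc 0) = 1"
  by (simp add: geom_poly_def)

lemma degree_geom_poly: "degree (geom_poly n) = n - 1"
proof (cases n)
  case (Suc k)
  then show ?thesis
    by (intro antisym degree_le le_degree) (auto simp: coeff_geom_poly)
qed (simp add: geom_poly_def)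

lemma lead_coeff_geom_poly: "n > 0 \<Longrightarrow> lead_coeff (geom_poly n) = 1"
  by (simp add: coeff_geom_poly degree_geom_poly)

lemma poly_geom_poly: "poly (of_int_poly (geom_poly n)) z = (\<Sum>j<n. z ^ j)"
  by (simp add: geom_poly_def of_int_poly_sum of_int_poly_monom poly_sum poly_monom)

lemma sum_roots_geom_poly:
  assumes "n > 1"
  shows "\<Sum>\<^sub># (proots (of_int_poly (geom_poly n) :: complex poly)) = -1"
  using coeff_monic_eq_neg_sum_roots[of "of_int_poly (geom_poly n)"] assms
  by (simp add: coeff_map_poly coeff_geom_poly degree_geom_poly minus_equation_iff)

context cotangent_family
begin

abbreviation "I \<equiv> {..<2 * m}"

text \<open>With \<open>D = (x - 1) U\<close> and \<open>W / D = \<Sum>\<^sub>i 1 / (x\<^bsup>a\<^sub>i\<^esup> - 1)\<close>, the polynomial below is \<open>x D F\<close>.\<close>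

definition U :: "int poly" where "U = (\<Prod>i\<in>I. geom_poly (a i))"

definition W :: "int poly" where "W = (\<Sum>i\<in>I. \<Prod>j\<in>I - {i}. geom_poly (a j))"

definition P :: "int poly" where
  "P = [:1, -1, -1, 1:] * U - smult (int m) ([:0, -1, 1:] * U) - [:0, 1:] * W"

definition F :: "'a::field_char_0 \<Rightarrow> 'a" where
  "F z = z - 1 / z - (\<Sum>i\<in>I. 1 / 2 + 1 / (z ^ a i - 1))"

lemma geom_poly_nz: "i \<in> I \<Longrightarrow> geom_poly (a i) \<noteq> 0"
  using lead_coeff_geom_poly[OF a_gt0[of i]] by auto

lemma degree_U: "degree U = (\<Sum>i\<in>I. a i - 1)"
  unfolding U_def by (subst degree_prod_sum_eq) (auto simp: geom_poly_nz degree_geom_poly)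

lemma lead_coeff_U: "lead_coeff U = 1"
  unfolding U_def lead_coeff_prod by (rule prod.neutral) (auto simp: lead_coeff_geom_poly a_gt0)

lemma degree_U_pos: "degree U > 0"
proof -
  have "a 1 - 1 \<le> degree U"
    unfolding degree_U using m2 by (intro member_le_sum) auto
  then show ?thesis by (simp add: a1[simplified])
qed

lemma degree_W: "degree W \<le> degree U"
  unfolding W_def
proof (rule degree_sum_le)
  fix i assume i: "i \<in> I"
  have "degree (\<Prod>j\<in>I - {i}. geom_poly (a j)) = (\<Sum>j\<in>I - {i}. a j - 1)"
    by (subst degree_prod_sum_eq) (auto simp: geom_poly_nz degree_geom_poly)
  also have "\<dots> \<le> degree U" unfolding degree_U by (rule sum_mono2) auto
  finally show "degree (\<Prod>j\<in>I - {i}. geom_poly (a j)) \<le> degree U" .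
qed simp

text \<open>Each factor of \<open>U\<close> has root sum -1, except the constant factor belonging to
  \<open>a 0 = 1\<close>.\<close>

lemma coeff_U: "coeff U (degree U - 1) = 2 * int m - 1"
proof -
  let ?U = "of_int_poly U :: complex poly"
  have "?U = (\<Prod>i\<in>I. of_int_poly (geom_poly (a i)))" unfolding U_def by (simp add: of_int_poly_prod)
  then have "proots ?U = (\<Sum>i\<in>I. proots (of_int_poly (geom_poly (a i))))"
    by (simp only:) (rule proots_prod, simp add: geom_poly_nz)
  then have "\<Sum>\<^sub># (proots ?U) = (\<Sum>i\<in>I. \<Sum>\<^sub># (proots (of_int_poly (geom_poly (a i)) :: complex poly)))"
    by (simp add: sum_mset_of_sum)
  also have "I = insert 0 {1..<2*m}" using m2 by auto
  also have "(\<Sum>i\<in>\<dots>. \<Sum>\<^sub># (proots (of_int_poly (geom_poly (a i)) :: complex poly)))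
      = (\<Sum>i\<in>{1..<2*m}. \<Sum>\<^sub># (proots (of_int_poly (geom_poly (a i)) :: complex poly)))"
    by (simp add: a0)
  also have "\<dots> = (\<Sum>i\<in>{1..<2*m}. -1)"
    by (intro sum.cong refl sum_roots_geom_poly a_gt1) auto
  also have "\<dots> = - (2 * of_nat m - 1)" using m2 by (simp add: of_nat_diff)
  finally have "coeff ?U (degree U - 1) = 2 * of_nat m - 1"
    using coeff_monic_eq_neg_sum_roots[of ?U] degree_U_pos lead_coeff_U by (simp add: coeff_map_poly)
  then have "of_int (coeff U (degree U - 1)) = (of_int (2 * int m - 1) :: complex)" by (simp add: coeff_map_poly)
  then show ?thesis by (simp only: of_int_eq_iff)
qed

text \<open>The term \<open>x * W\<close> has degree at most \<open>degree U + 1\<close>, so it does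
  not reach the top two coefficients. The second one collects \<open>2 * m - 1\<close> from
  \<open>U\<close>, \<open>-1\<close> from the cubic factor, and \<open>- m\<close>.\<close>

lemma coeff_P:
  shows "coeff P (degree U + 3) = 1" "degree P = degree U + 3"
    "coeff P (degree U + 2) = int m - 2"
proof -
  obtain N where N: "degree U = Suc N" using degree_U_pos by (cases "degree U") auto
  have U: "coeff U (Suc N) = 1" "coeff U N = 2 * int m - 1" "\<And>i. i > Suc N \<Longrightarrow> coeff U i = 0"
    and W: "\<And>i. i > Suc N \<Longrightarrow> coeff W i = 0"
    using lead_coeff_U coeff_U degree_W by (auto simp: N coeff_eq_0)
  show 1: "coeff P (degree U + 3) = 1"
    by (simp add: P_def N U W numeral_3_eq_3)
  show "coeff P (degree U + 2) = int m - 2"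
    by (simp add: P_def N U W numeral_2_eq_2)
  show "degree P = degree U + 3"
  proof (rule antisym[OF degree_le le_degree]; (intro allI impI)?)
    fix i assume "degree U + 3 < i"
    then have "i = Suc (Suc (Suc (i - 3)))" "i - 3 > Suc N" using N by simp_all
    then obtain k where "i = Suc (Suc (Suc k))" "k > Suc N" by blast
    then show "coeff P i = 0" by (simp add: P_def U W)
  qed (use 1 in simp)
qed

lemma lead_coeff_P: "lead_coeff P = 1"
  using coeff_P by simp

section \<open>Values of \<open>P\<close> and the rational function \<open>F\<close>\<close>

lemma poly_U: "poly (of_int_poly U) z = (\<Prod>i\<in>I. \<Sum>j<a i. z ^ j)"
  by (simp add: U_def of_int_poly_prod poly_prod poly_geom_poly)

lemma poly_W: "poly (of_int_poly W) z = (\<Sum>i\<in>I. \<Prod>k\<in>I - {i}. \<Sum>j<a k. z ^ j)"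
  by (simp add: W_def of_int_poly_prod of_int_poly_sum poly_sum poly_prod poly_geom_poly)

text \<open>This form also holds at 0 and at the poles of \<open>F\<close>, where \<open>P\<close>
  has to be evaluated as well.\<close>

lemma poly_P:
  fixes z :: "'a::field_char_0"
  shows "poly (of_int_poly P) z = (z - 1)\<^sup>2 * (z + 1) * poly (of_int_poly U) z
      - of_nat m * (z * (z - 1) * poly (of_int_poly U) z) - z * poly (of_int_poly W) z"
proof -
  have "poly (of_int_poly [:1, -1, -1, 1:]) z = (z - 1)\<^sup>2 * (z + 1)"
    "poly (of_int_poly [:0, -1, 1:]) z = z * (z - 1)" "poly (of_int_poly [:0, 1:]) z = z"
    by (simp_all add: map_poly_pCons power2_eq_square algebra_simps)
  then show ?thesis unfolding P_def of_int_poly_hom poly_diff poly_mult poly_smult by simp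
qed

lemma poly_P_eq_F:
  fixes z :: "'a::field_char_0"
  assumes "z \<noteq> 0" "\<And>i. i \<in> I \<Longrightarrow> z ^ a i \<noteq> 1"
  shows "poly (of_int_poly P) z = z * (z - 1) * poly (of_int_poly U) z * F z"
    "poly (of_int_poly U) z \<noteq> 0"
proof -
  let ?u = "poly (of_int_poly U) z"
  have z1: "z \<noteq> 1" using assms(2)[of 0] m2 by auto
  have g: "(\<Sum>j<a i. z ^ j) \<noteq> 0" if "i \<in> I" for i
    using assms(2)[OF that] power_diff_1_eq[of z "a i"] by auto
  then show "?u \<noteq> 0" unfolding poly_U by simp
  have "poly (of_int_poly W) z = (\<Sum>i\<in>I. ?u * ((z - 1) / (z ^ a i - 1)))"
    unfolding poly_W
  proof (rule sum.cong[OF refl])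
    fix i assume i: "i \<in> I"
    have "?u = (\<Sum>j<a i. z ^ j) * (\<Prod>k\<in>I - {i}. \<Sum>j<a k. z ^ j)"
      unfolding poly_U using i by (intro prod.remove) auto
    then show "(\<Prod>k\<in>I - {i}. \<Sum>j<a k. z ^ j) = ?u * ((z - 1) / (z ^ a i - 1))"
      using z1 g[OF i] by (simp add: power_diff_1_eq)
  qed
  also have "\<dots> = (z - 1) * ?u * (\<Sum>i\<in>I. 1 / (z ^ a i - 1))"
    by (simp add: sum_distrib_left mult_ac)
  finally have W: "poly (of_int_poly W) z = (z - 1) * ?u * (\<Sum>i\<in>I. 1 / (z ^ a i - 1))" .
  have F: "F z = z - 1 / z - of_nat m - (\<Sum>i\<in>I. 1 / (z ^ a i - 1))"
    by (simp add: F_def sum.distrib)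
  have "z * F z = z\<^sup>2 - 1 - z * of_nat m - z * (\<Sum>i\<in>I. 1 / (z ^ a i - 1))"
    unfolding F using assms(1) by (simp add: field_simps power2_eq_square)
  moreover have "z * (z - 1) * ?u * F z = (z - 1) * ?u * (z * F z)" by (simp only: mult_ac)
  ultimately have "z * (z - 1) * ?u * F z = (z - 1) * ?u * (z\<^sup>2 - 1 - z * of_nat m - z * (\<Sum>i\<in>I. 1 / (z ^ a i - 1)))"
    by simp
  then show "poly (of_int_poly P) z = z * (z - 1) * ?u * F z"
    unfolding poly_P W by (simp add: algebra_simps power2_eq_square)
qed

lemma poly_P_0: "poly (of_int_poly P) (0::'a::field_char_0) = 1"
proof -
  have "poly (of_int_poly U) (0::'a) = (\<Prod>i\<in>I. 1)" unfolding poly_U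
    by (intro prod.cong refl) (simp add: power_0_left a_gt0)
  then show ?thesis by (simp add: poly_P)
qed

lemma poly_P_1: "poly (of_int_poly P) (1::real) < 0"
proof -
  have "0 < (\<Sum>i\<in>I. \<Prod>k\<in>I - {i}. real (a k))"
    using m2 by (intro sum_pos prod_pos) (auto simp: a_gt0 lessThan_empty_iff)
  then show ?thesis by (simp add: poly_P poly_W)
qed

text \<open>Each summand is \<open>(w + 1) / (2 * (w - 1))\<close> with \<open>w = z ^ a i\<close>,
  which changes sign under \<open>w -> 1 / w\<close>.\<close>

lemma F_minus:
  fixes z :: "'a::field_char_0"
  assumes "z \<noteq> 0" "\<And>i. i \<in> I \<Longrightarrow> z ^ a i \<noteq> 1"
  shows "F (1 / z) = - F z"
proof -
  have "(\<Sum>i\<in>I. 1 / 2 + 1 / ((1 / z) ^ a i - 1)) = (\<Sum>i\<in>I. - (1 / 2 + 1 / (z ^ a i - 1)))"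
  proof (intro sum.cong refl)
    fix i assume i: "i \<in> I"
    have w: "w \<noteq> 0 \<Longrightarrow> w \<noteq> 1 \<Longrightarrow> 1 / 2 + 1 / (1 / w - 1) = - (1 / 2 + 1 / (w - 1))" for w :: 'a
    proof -
      assume w: "w \<noteq> 0" "w \<noteq> 1"
      have "1 / (1 / w - 1) = w / (1 - w)" using w by (simp add: field_simps)
      also have "\<dots> = -1 - 1 / (w - 1)" using w by (simp add: divide_simps) (simp add: algebra_simps)
      finally show ?thesis by simp
    qed
    show "1 / 2 + 1 / ((1 / z) ^ a i - 1) = - (1 / 2 + 1 / (z ^ a i - 1))"
      using w[of "z ^ a i"] assms i by (simp add: power_one_over)
  qed
  then show ?thesis unfolding F_def by (simp only: sum_negf) simp
qed

section \<open>Zeros off the unit circle\<close>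

lemma power_ne_1_if_norm_ne_1:
  fixes z :: complex
  assumes "norm z \<noteq> 1" "i \<in> I"
  shows "z ^ a i \<noteq> 1"
proof
  assume "z ^ a i = 1"
  then have "norm z ^ a i = 1 ^ a i" by (metis norm_one norm_power power_one)
  then show False using assms a_gt0[of i] power_eq_imp_eq_base[of "norm z" "a i" 1] by simp
qed

lemma root_iff_F:
  fixes z :: complex
  assumes "norm z \<noteq> 1" "z \<noteq> 0"
  shows "poly (of_int_poly P) z = 0 \<longleftrightarrow> F z = 0"
  using poly_P_eq_F[of z] power_ne_1_if_norm_ne_1[OF assms(1)] assms by auto

lemma root_reciprocal:
  fixes z :: complex
  assumes "norm z \<noteq> 1" "poly (of_int_poly P) z = 0"
  shows "poly (of_int_poly P) (1 / z) = 0"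
proof -
  have z: "z \<noteq> 0" using assms(2) poly_P_0[where 'a = complex] by auto
  then have "norm (1 / z) \<noteq> 1" using assms(1) by (simp add: norm_divide)
  then show ?thesis using z root_iff_F F_minus[OF z] power_ne_1_if_norm_ne_1[OF assms(1)] assms by simp
qed

text \<open>For \<open>x = z ^ a i\<close> and \<open>y = v ^ a i\<close>, the numerator is
  \<open>z * v - 1\<close> times a geometric sum, which exhibits the positive semidefinite
  kernel.\<close>

lemma partial_fractions:
  fixes x y :: "'b::field_char_0"
  assumes "x \<noteq> 1" "y \<noteq> 1"
  shows "(x * y - 1) / ((x - 1) * (y - 1)) = (1 / 2 + 1 / (x - 1)) + (1 / 2 + 1 / (y - 1))"
  using assms by (simp add: divide_simps) (simp add: algebra_simps)

text \<open>On the zeros of \<open>F\<close> outside the unit disc, \<open>1/z + 1/cnj w\<close> is a Gram matrix, so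
  Cauchy--Schwarz applies to it; but for \<open>z \<noteq> w\<close> its determinant is \<open>- |1/z - 1/w|\<^sup>2 < 0\<close>.\<close>

lemma root_outside_unique:
  fixes z w :: complex
  assumes "poly (of_int_poly P) z = 0" "norm z > 1" "poly (of_int_poly P) w = 0" "norm w > 1"
  shows "z = w"
proof -
  define S where "S = Sigma I (\<lambda>i. {..<a i})"
  \<comment> \<open>The coordinates are chosen so that, for fixed \<open>i\<close>, the inner
    product of \<open>X z\<close> and \<open>X w\<close> over \<open>j\<close> is a geometric sum in
    \<open>z * cnj w\<close> over the product of the two denominators.\<close>
  define X where "X = (\<lambda>(z::complex) (i, j). z ^ j / (z ^ a i - 1))"
  have gram: "1 / z + cnj (1 / w) = (\<Sum>s\<in>S. X z s * cnj (X w s))"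
    if z: "poly (of_int_poly P) z = 0" "norm z > 1" and w: "poly (of_int_poly P) w = 0" "norm w > 1" for z w
  proof -
    define v where "v = cnj w"
    have nz: "z \<noteq> 0" "v \<noteq> 0" "w \<noteq> 0" using z w by (auto simp: v_def)
    have "norm (z * v) > 1" using z w by (simp add: v_def norm_mult less_1_mult)
    then have zv: "z * v \<noteq> 1" by auto
    have Fz: "z - 1 / z = (\<Sum>i\<in>I. 1 / 2 + 1 / (z ^ a i - 1))"
      using root_iff_F[of z] z nz by (simp add: F_def)
    have "w - 1 / w = (\<Sum>i\<in>I. 1 / 2 + 1 / (w ^ a i - 1))"
      using root_iff_F[of w] w nz by (simp add: F_def)
    then have "cnj (w - 1 / w) = cnj (\<Sum>i\<in>I. 1 / 2 + 1 / (w ^ a i - 1))" by simp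
    then have Fw: "v - 1 / v = (\<Sum>i\<in>I. 1 / 2 + 1 / (v ^ a i - 1))"
      by (simp add: v_def)
    have summand: "(1 / 2 + 1 / (z ^ a i - 1)) + (1 / 2 + 1 / (v ^ a i - 1))
        = (z * v - 1) * (\<Sum>j<a i. X z (i, j) * cnj (X w (i, j)))" if i: "i \<in> I" for i
    proof -
      have ne: "z ^ a i \<noteq> 1" "w ^ a i \<noteq> 1"
        using power_ne_1_if_norm_ne_1 i z w by auto
      have ne': "v ^ a i \<noteq> 1" using ne(2) unfolding v_def by (metis complex_cnj_cnj complex_cnj_one complex_cnj_power)
      have "(\<Sum>j<a i. X z (i, j) * cnj (X w (i, j))) = (\<Sum>j<a i. (z * v) ^ j) / ((z ^ a i - 1) * (v ^ a i - 1))"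
        by (simp add: X_def v_def power_mult_distrib sum_divide_distrib)
      then have "(z * v - 1) * (\<Sum>j<a i. X z (i, j) * cnj (X w (i, j)))
          = ((z * v) ^ a i - 1) / ((z ^ a i - 1) * (v ^ a i - 1))"
        by (simp add: power_diff_1_eq)
      also have "\<dots> = (1 / 2 + 1 / (z ^ a i - 1)) + (1 / 2 + 1 / (v ^ a i - 1))"
        unfolding power_mult_distrib by (rule partial_fractions[OF ne(1) ne'])
      finally show ?thesis by simp
    qed
    have "(z - 1 / z) + (v - 1 / v) = (\<Sum>i\<in>I. (z * v - 1) * (\<Sum>j<a i. X z (i, j) * cnj (X w (i, j))))"
      unfolding Fz Fw sum.distrib[symmetric] using summand by (intro sum.cong refl) simp
    also have "\<dots> = (z * v - 1) * (\<Sum>s\<in>S. X z s * cnj (X w s))"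
      unfolding S_def by (simp add: sum.Sigma sum_distrib_left case_prod_unfold)
    finally have eq: "(z - 1 / z) + (v - 1 / v) = (z * v - 1) * (\<Sum>s\<in>S. X z s * cnj (X w s))" .
    \<comment> \<open>The left side of the equation for the zeros contains the same factor
      \<open>z * v - 1\<close>, so cancelling it leaves the Gram matrix.\<close>
    have "(z - 1 / z) + (v - 1 / v) = (z * v - 1) * (1 / z + 1 / v)"
      using nz by (simp add: field_simps)
    then have "1 / z + 1 / v = (\<Sum>s\<in>S. X z s * cnj (X w s))" using eq zv by simp
    then show ?thesis by (simp add: v_def)
  qed
  define s t where "s = 1 / z" and "t = 1 / w"
  have diag: "2 * Re (1 / z) = (\<Sum>k\<in>S. (norm (X z k))\<^sup>2)"
    if z: "poly (of_int_poly P) z = 0" "norm z > 1" for z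
  proof -
    have "Re (1 / z + cnj (1 / z)) = Re (\<Sum>s\<in>S. X z s * cnj (X z s))"
      using gram[OF z z] by simp
    also have "\<dots> = (\<Sum>k\<in>S. (norm (X z k))\<^sup>2)"
      by (simp add: complex_norm_square[symmetric] complex_mult_cnj cmod_power2)
    finally show ?thesis by (simp only: plus_complex.sel cnj.sel)
  qed
  have "s + cnj t = (\<Sum>k\<in>S. X z k * cnj (X w k))"
    unfolding s_def t_def by (rule gram[OF assms])
  then have "norm (s + cnj t) \<le> (\<Sum>k\<in>S. norm (X z k * cnj (X w k)))"
    by (simp only: norm_sum)
  also have "\<dots> = (\<Sum>k\<in>S. norm (X z k) * norm (X w k))" by (simp add: norm_mult)
  finally have "(norm (s + cnj t))\<^sup>2 \<le> (\<Sum>k\<in>S. norm (X z k) * norm (X w k))\<^sup>2"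
    by (intro power_mono) auto
  also have "\<dots> \<le> (\<Sum>k\<in>S. (norm (X z k))\<^sup>2) * (\<Sum>k\<in>S. (norm (X w k))\<^sup>2)"
    by (rule Cauchy_Schwarz_ineq_sum)
  also have "\<dots> = (2 * Re s) * (2 * Re t)"
    unfolding s_def t_def by (simp only: diag[OF assms(1,2)] diag[OF assms(3,4)])
  finally have "(Re s + Re t)\<^sup>2 + (Im s - Im t)\<^sup>2 \<le> 4 * Re s * Re t"
    by (simp add: cmod_power2)
  moreover have "(Re s + Re t)\<^sup>2 = (Re s - Re t)\<^sup>2 + 4 * Re s * Re t"
    by (simp add: power2_eq_square algebra_simps)
  ultimately have "(Re s - Re t)\<^sup>2 + (Im s - Im t)\<^sup>2 \<le> 0" by linarith
  then have "Re s = Re t" "Im s = Im t"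
    unfolding sum_power2_le_zero_iff by simp_all
  then have "s = t" by (simp add: complex_eq_iff)
  then show "z = w" by (simp add: s_def t_def)
qed

section \<open>The real zero outside the disc\<close>

lemma F_diff_ge:
  fixes x y :: real
  assumes "1 < y" "y < x"
  shows "F x - F y \<ge> x - y"
proof -
  \<comment> \<open>The linear term contributes exactly \<open>x - y\<close>; the remaining terms of
    \<open>F\<close> increase on the half-line above 1.\<close>
  have "1 / x \<le> 1 / y" using assms by (intro divide_left_mono) auto
  moreover have "(\<Sum>i\<in>I. 1 / 2 + 1 / (x ^ a i - 1)) \<le> (\<Sum>i\<in>I. 1 / 2 + 1 / (y ^ a i - 1))"
  proof (intro sum_mono add_left_mono divide_left_mono)
    fix i assume "i \<in> I"
    then have "a i > 0" using a_gt0 by simp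
    then have gt1: "1 < y ^ a i" "1 < x ^ a i" using assms by (auto intro: one_less_power)
    have "y ^ a i \<le> x ^ a i" using assms by (intro power_mono) auto
    then show "y ^ a i - 1 \<le> x ^ a i - 1" by simp
    show "0 < (x ^ a i - 1) * (y ^ a i - 1)" using gt1 by simp
  qed simp
  ultimately show ?thesis by (simp add: F_def)
qed

lemma ex_real_root: "\<exists>\<alpha>>1. poly (of_int_poly P) (\<alpha>::real) = 0"
proof -
  have lc: "lead_coeff (of_int_poly P :: real poly) = 1"
    using lead_coeff_P by (simp add: coeff_map_poly)
  then obtain n where n: "\<And>x. x \<ge> n \<Longrightarrow> poly (of_int_poly P) (x::real) \<ge> 1"
    using poly_pinfty_gt_lc[of "of_int_poly P :: real poly"] by auto
  have "poly (of_int_poly P) (max 2 n) > 0" using n[of "max 2 n"] by simp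
  moreover have "1 < max 2 n" by simp
  ultimately show ?thesis
    using poly_IVT_pos[of 1 "max 2 n" "of_int_poly P"] poly_P_1 by blast
qed

text \<open>To the right of \<alpha>, \<open>F x \<ge> x - \<alpha>\<close>, hence \<open>P\<close>
  is at least \<open>(x - \<alpha>) * x * (x - 1) * U\<close>. A double zero would allow dividing by
  \<open>x - \<alpha>\<close> and letting \<open>x\<close> tend to \<alpha>, so that
  \<open>\<alpha> * (\<alpha> - 1) * U(\<alpha>) \<le> 0\<close>.\<close>

lemma real_root_simple:
  fixes \<alpha> :: real
  assumes \<alpha>: "\<alpha> > 1" and eq: "of_int_poly P = f * g" and roots: "poly f \<alpha> = 0" "poly g \<alpha> = 0"
  shows False
proof -
  obtain f' g' where fg: "f = [:-\<alpha>, 1:] * f'" "g = [:-\<alpha>, 1:] * g'"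
    using roots by (auto simp: poly_eq_0_iff_dvd elim!: dvdE)
  then have P: "poly (of_int_poly P) x = (x - \<alpha>) * ((x - \<alpha>) * poly (f' * g') x)" for x
    unfolding eq fg poly_mult by (simp add: algebra_simps)
  have ne: "x ^ a i \<noteq> 1" if "x > 1" "i \<in> I" for x :: real and i
  proof -
    have "1 < x ^ a i" using a_gt0[of i] that by (intro one_less_power) auto
    then show ?thesis by linarith
  qed
  define Q where "Q = [:-\<alpha>, 1:] * (f' * g') - [:0, 1:] * [:-1, 1:] * of_int_poly U"
  have U_pos: "poly (of_int_poly U) x > 0" if "x > 1" for x :: real
    unfolding poly_U using that a_gt0 by (intro prod_pos ballI sum_pos) (auto simp: lessThan_empty_iff)
  have Fa: "F \<alpha> = 0"
    using poly_P_eq_F[of \<alpha>] ne \<alpha> P[of \<alpha>] by auto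
  have Q_nonneg: "poly Q x \<ge> 0" if x: "x > \<alpha>" for x
  proof -
    have x1: "x > 1" using x \<alpha> by simp
    have "x * (x - 1) * poly (of_int_poly U) x * (x - \<alpha>) \<le> x * (x - 1) * poly (of_int_poly U) x * F x"
      using F_diff_ge[OF \<alpha> x] Fa U_pos[OF x1] x1 by (intro mult_left_mono) auto
    also have "\<dots> = poly (of_int_poly P) x" using poly_P_eq_F(1)[of x] ne[OF x1] x1 by simp
    finally have "(x - \<alpha>) * (x * (x - 1) * poly (of_int_poly U) x) \<le> (x - \<alpha>) * ((x - \<alpha>) * poly (f' * g') x)"
      unfolding P by (simp only: mult_ac)
    then have "x * (x - 1) * poly (of_int_poly U) x \<le> (x - \<alpha>) * poly (f' * g') x"
      using x by (simp add: mult_le_cancel_left_pos)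
    moreover have "poly Q x = (x - \<alpha>) * poly (f' * g') x - x * (x - 1) * poly (of_int_poly U) x"
      unfolding Q_def poly_diff poly_mult by simp
    ultimately show ?thesis by simp
  qed
  have "poly Q \<alpha> = - (\<alpha> * (\<alpha> - 1) * poly (of_int_poly U) \<alpha>)"
    unfolding Q_def poly_diff poly_mult by simp
  then have "poly Q \<alpha> < 0" using U_pos[OF \<alpha>] \<alpha> by simp
  moreover have "(poly Q \<longlongrightarrow> poly Q \<alpha>) (at_right \<alpha>)"
    by (rule tendsto_within_subset[OF isCont_def[THEN iffD1]]) auto
  then have "poly Q \<alpha> \<ge> 0"
    by (rule tendsto_lowerbound) (auto simp: eventually_at_right_less eventually_at_filter intro!: Q_nonneg always_eventually)
  ultimately show False by simp
qed

section \<open>Nonvanishing at roots of unity\<close>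

lemma cis_power_eq_1_iff:
  assumes "n > 0"
  shows "cis (2 * pi / real n) ^ k = 1 \<longleftrightarrow> n dvd k"
proof -
  have "\<i> * of_real (real k * (2 * pi / real n)) = 2 * of_real pi * \<i> * of_nat k / of_nat n"
    by simp
  then show ?thesis
    unfolding Complex.DeMoivre unfolding cis_conv_exp using complex_root_unity_eq_1[of n k] assms
    by (simp only:)
qed

text \<open>Factoring out \<open>cis x\<close> turns \<open>cis (2 * x) - 1\<close> and
  \<open>cis (2 * x) + 1\<close> into a sine and a cosine, so the summands of \<open>F\<close>
  become imaginary multiples of cotangents.\<close>

lemma half_plus_inverse_cis:
  assumes "cis (2 * x) \<noteq> 1"
  shows "1 / 2 + 1 / (cis (2 * x) - 1) = - (\<i> / 2) * of_real (cot x)"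
proof -
  have sq: "cis (2 * x) = cis x * cis x" by (simp add: cis_mult)
  have e: "cis x * cis (- x) = 1" by (simp add: cis_mult)
  have m: "cis (2 * x) - 1 = cis x * (2 * \<i> * of_real (sin x))"
    and p: "cis (2 * x) + 1 = cis x * (2 * of_real (cos x))"
  proof -
    have "cis (2 * x) - 1 = cis x * (cis x - cis (- x))" using sq e by (simp add: algebra_simps)
    also have "cis x - cis (- x) = 2 * \<i> * of_real (sin x)" by (simp add: complex_eq_iff)
    finally show "cis (2 * x) - 1 = cis x * (2 * \<i> * of_real (sin x))" .
    have "cis (2 * x) + 1 = cis x * (cis x + cis (- x))" using sq e by (simp add: algebra_simps)
    also have "cis x + cis (- x) = 2 * of_real (cos x)" by (simp add: complex_eq_iff)
    finally show "cis (2 * x) + 1 = cis x * (2 * of_real (cos x))" .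
  qed
  have ne: "cis (2 * x) - 1 \<noteq> 0" using assms by simp
  then have s: "sin x \<noteq> 0" unfolding m by auto
  have "1 / 2 + 1 / (cis (2 * x) - 1) = (cis (2 * x) + 1) / (2 * (cis (2 * x) - 1))"
    using ne by (simp add: divide_simps)
  also have "\<dots> = of_real (cos x) / (2 * \<i> * of_real (sin x))"
    unfolding m p using s by (simp add: divide_simps)
  also have "\<dots> = - (\<i> / 2) * of_real (cot x)"
    using s by (simp add: cot_def divide_simps)
  finally show ?thesis .
qed

text \<open>If \<open>n > 1\<close> divides some \<open>a i\<close>, coprimality makes
  \<open>i\<close> unique: \<open>U\<close> vanishes, but exactly one product in \<open>W\<close>
  survives. If \<open>n > 1\<close> divides none, then \<open>n \<ge> 3\<close> because
  \<open>a 1 = 2\<close>, and \<open>F\<close> is \<open>\<i> / 2\<close> times the positive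
  cotangent expression.\<close>

lemma poly_P_root_of_unity:
  assumes n: "n > 0"
  shows "poly (of_int_poly P) (cis (2 * pi / real n)) \<noteq> 0"
proof -
  let ?z = "cis (2 * pi / real n)"
  note one_iff = cis_power_eq_1_iff[OF n]
  consider "n = 1" | i where "n > 1" "i \<in> I" "n dvd a i" | "n > 1" "\<And>i. i \<in> I \<Longrightarrow> \<not> n dvd a i"
    using n by (cases "n = 1") auto
  then show ?thesis
  proof cases
    case 1
    have "poly (of_int_poly P) (of_real 1 :: complex) \<noteq> 0"
      unfolding of_int_poly_of_real using poly_P_1 by simp
    then show ?thesis using 1 by simp
  next
    case 2
    have z1: "?z \<noteq> 1" using one_iff[of 1] 2(1) by simp
    have geom: "(\<Sum>j<k. ?z ^ j) = 0 \<longleftrightarrow> n dvd k" for k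
      using power_diff_1_eq[of ?z k] z1 one_iff[of k] by auto
    \<comment> \<open>If \<open>n\<close> divided two exponents, it would divide both
      \<open>a j\<close> and \<open>a j - 1\<close> for the later index \<open>j\<close>.\<close>
    have nd: "\<not> n dvd a k" if k: "k \<in> I - {i}" for k
    proof
      assume "n dvd a k"
      then have ne0: "k \<noteq> 0" "i \<noteq> 0" using 2(1,3) a0 by (auto intro!: Nat.gr0I)
      have "\<exists>j. n dvd a j \<and> n dvd a j - 1 \<and> a j > 0"
      proof (cases "i < k")
        case True
        have "a i + 0 dvd a k - 1" using True k m2 ne0 by (intro a_cong) auto
        then show ?thesis using \<open>n dvd a k\<close> 2(3) k by (auto intro!: exI[of _ k] a_gt0 dvd_trans[of n "a i"])
      next
        case False
        have "a k + 0 dvd a i - 1" using False k 2(2) m2 ne0 by (intro a_cong) auto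
        then show ?thesis using \<open>n dvd a k\<close> 2(2,3) by (auto intro!: exI[of _ i] a_gt0 dvd_trans[of n "a k"])
      qed
      then obtain j where j: "n dvd a j" "n dvd a j - 1" "a j > 0" by blast
      have "n dvd a j - (a j - 1)" using j(1,2) by (rule dvd_diff_nat)
      also have "a j - (a j - 1) = 1" using j(3) by simp
      finally show False using 2(1) by simp
    qed
    have "poly (of_int_poly U) ?z = 0"
      unfolding poly_U using 2 geom by (intro prod_zero) auto
    moreover have "poly (of_int_poly W) ?z = (\<Prod>k\<in>I - {i}. \<Sum>j<a k. ?z ^ j)"
    proof -
      have "poly (of_int_poly W) ?z = (\<Sum>l\<in>I. if l = i then (\<Prod>k\<in>I - {i}. \<Sum>j<a k. ?z ^ j) else 0)"
        unfolding poly_W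
      proof (intro sum.cong refl)
        fix l assume "l \<in> I"
        show "(\<Prod>k\<in>I - {l}. \<Sum>j<a k. ?z ^ j) = (if l = i then (\<Prod>k\<in>I - {i}. \<Sum>j<a k. ?z ^ j) else 0)"
          using 2 geom by (auto intro!: prod_zero bexI[of _ i])
      qed
      then show ?thesis using 2(2) by simp
    qed
    moreover have "(\<Prod>k\<in>I - {i}. \<Sum>j<a k. ?z ^ j) \<noteq> 0"
      using nd geom by (simp add: prod_zero_iff)
    ultimately show ?thesis by (simp add: poly_P)
  next
    case 3
    have "n \<noteq> 2" using 3(2)[of 1] m2 by (auto simp: a1[simplified])
    then have n3: "n \<ge> 3" using 3(1) by simp
    have ne: "?z ^ a i \<noteq> 1" if "i \<in> I" for i using 3(2)[OF that] one_iff by simp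
    have summand: "1 / 2 + 1 / (?z ^ a i - 1) = - (\<i> / 2) * of_real (cot (pi * real (a i) / real n))"
      if "i \<in> I" for i
    proof -
      have "?z ^ a i = cis (2 * (pi * real (a i) / real n))"
        by (simp add: Complex.DeMoivre mult_ac)
      then show ?thesis using half_plus_inverse_cis[of "pi * real (a i) / real n"] ne[OF that] by simp
    qed
    have "?z - 1 / ?z = 2 * \<i> * of_real (sin (2 * pi / real n))"
    proof -
      have "1 / ?z = cis (- (2 * pi / real n))" by (simp only: divide_inverse cis_inverse mult_1_left)
      then show ?thesis by (simp add: complex_eq_iff)
    qed
    then have "F ?z = 2 * \<i> * of_real (sin (2 * pi / real n))
        - (\<Sum>i\<in>I. - (\<i> / 2) * of_real (cot (pi * real (a i) / real n)))"
      unfolding F_def using summand by simp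
    also have "\<dots> = (\<i> / 2) * of_real (4 * sin (2 * pi / real n) + (\<Sum>i\<in>I. cot (pi * real (a i) / real n)))"
    proof -
      have "(\<Sum>i\<in>I. - (\<i> / 2) * of_real (cot (pi * real (a i) / real n)))
          = - (\<i> / 2) * of_real (\<Sum>i\<in>I. cot (pi * real (a i) / real n))"
        by (simp only: sum_distrib_left of_real_sum)
      then show ?thesis by (simp only:) (simp add: algebra_simps)
    qed
    finally have "F ?z \<noteq> 0"
      using cot_sum_pos[OF n3] 3(2) by (simp only: mult_eq_0_iff of_real_eq_0_iff) auto
    moreover have "?z \<noteq> 1" using one_iff[of 1] 3(1) by simp
    ultimately show ?thesis using poly_P_eq_F[of ?z] ne by simp
  qed
qed

end

section \<open>Irreducibility\<close>

text \<open>Separability: \<open>h\<close> is also the minimal polynomial of each of its roots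
  \<open>w\<close>, so if the derivative vanished at \<open>w\<close>, it would be divisible by
  \<open>h\<close>, against its smaller degree.\<close>

lemma card_roots_minimal_poly:
  assumes "is_minimal_poly x h"
  shows "card {z::complex. poly (map_poly of_rat h) z = 0} = degree h"
proof -
  let ?h = "map_poly of_rat h :: complex poly"
  have h: "lead_coeff h = 1" "irreducible h" using assms by (auto simp: is_minimal_poly_def)
  have deg: "degree h > 0"
  proof (rule Nat.gr0I)
    assume "degree h = 0"
    then have "h = 1" using h(1) by (auto elim: degree_eq_zeroE)
    then show False using h(2) by simp
  qed
  have pd: "pderiv ?h = map_poly of_rat (pderiv h)"
    by (rule poly_eqI) (simp add: coeff_pderiv coeff_map_poly of_rat_mult of_rat_add)
  have "rsquarefree ?h"
    unfolding rsquarefree_roots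
  proof (intro allI notI)
    fix w assume w: "poly ?h w = 0 \<and> poly (pderiv ?h) w = 0"
    then have "is_minimal_poly w h" using h by (simp add: is_minimal_poly_def)
    then have "h dvd pderiv h" using w unfolding pd by (intro is_minimal_poly_dvd) auto
    then show False using deg 
      using dvd_imp_degree_le[of h "pderiv h"] by (simp add: degree_pderiv pderiv_eq_0_iff)
  qed
  then have "smult (lead_coeff ?h) (\<Prod>z|poly ?h z = 0. [:-z, 1:]) = ?h"
    by (rule complex_poly_decompose_rsquarefree)
  moreover have "degree ?h = degree h" "lead_coeff ?h = 1"
    using h by (auto simp: degree_map_poly coeff_map_poly)
  ultimately have "degree h = degree (\<Prod>z|poly ?h z = 0. [:-z, 1:])" by (metis smult_1_left)
  also have "\<dots> = card {z. poly ?h z = 0}" by (subst degree_prod_sum_eq) auto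
  finally show ?thesis by simp
qed

section \<open>The minimal polynomial and the conjugates of the real zero\<close>

context cotangent_family
begin

context
  fixes \<alpha> :: real
  assumes \<alpha>1: "\<alpha> > 1" and \<alpha>: "poly (of_int_poly P) \<alpha> = 0"
begin

lemma complex_root_alpha: "poly (of_int_poly P) (complex_of_real \<alpha>) = 0"
  using \<alpha> by (simp add: of_int_poly_of_real)

lemma root_norm_le_1:
  assumes "poly (of_int_poly P) z = 0" "z \<noteq> complex_of_real \<alpha>"
  shows "norm z \<le> 1"
  using root_outside_unique[OF assms(1) _ complex_root_alpha] \<alpha>1 assms(2) by force

lemma algebraic_int_alpha: "algebraic_int \<alpha>"
  using \<alpha> lead_coeff_P by (auto simp: algebraic_int_altdef_ipoly)

lemma is_minimal_poly_alpha: "is_minimal_poly \<alpha> (minimal_poly \<alpha>)"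
  using algebraic_int_alpha by (intro is_minimal_poly_minimal_poly) auto

text \<open>A nonconstant cofactor \<open>g\<close> would have a zero \<open>w\<close> whose minimal
  polynomial divides \<open>g\<close> and is integral. Simplicity of \<alpha> keeps all its zeros in
  the closed disc, so it vanishes at some \<open>cis (2 * pi / n)\<close>, where \<open>P\<close>
  does not.\<close>

lemma minimal_poly_alpha: "minimal_poly \<alpha> = of_int_poly P"
proof -
  define p where "p = minimal_poly \<alpha>"
  have p: "lead_coeff p = 1" "poly (map_poly of_rat p) \<alpha> = 0"
    using is_minimal_poly_alpha by (auto simp: p_def is_minimal_poly_def)
  have "p dvd of_int_poly P"
    unfolding p_def using is_minimal_poly_alpha \<alpha>
    by (intro is_minimal_poly_dvd) (auto simp: of_rat_of_int_poly)
  then obtain g where g: "of_int_poly P = p * g" by (auto elim: dvdE)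
  have lc: "lead_coeff g = 1"
    using arg_cong[OF g, of lead_coeff] p(1) lead_coeff_P by (simp add: lead_coeff_mult coeff_map_poly)
  have P_eq: "of_int_poly P = map_poly of_rat p * (map_poly of_rat g :: 'a::field_char_0 poly)"
    using arg_cong[OF g, of "map_poly of_rat"] by (simp add: of_rat_of_int_poly map_poly_of_rat_mult)
  have "degree g = 0"
  proof (rule ccontr)
    assume "degree g \<noteq> 0"
    then have "degree (map_poly of_rat g :: complex poly) \<noteq> 0" by (simp add: degree_map_poly)
    then obtain w :: complex where w: "poly (map_poly of_rat g) w = 0"
      using alg_closed_imp_poly_has_root[of "map_poly of_rat g"] by auto
    have "g \<noteq> 0" using lc by auto
    then obtain q where q: "is_minimal_poly w q" using ex_is_minimal_poly[OF _ w] by blast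
    have "q dvd g" using is_minimal_poly_dvd[OF q w] .
    then obtain g' where g': "g = q * g'" by (auto elim: dvdE)
    have lc_q: "lead_coeff q = 1" using q by (simp add: is_minimal_poly_def)
    have "of_int_poly P = q * (p * g')" unfolding g g' by (simp add: mult_ac)
    then obtain h where h: "q = of_int_poly h" "lead_coeff h = 1"
      using monic_factor_integral[OF lead_coeff_P _ lc_q] by metis
    define Z where "Z = {z::complex. poly (of_int_poly h) z = 0}"
    have Z: "poly (map_poly of_rat g) z = 0" "poly (of_int_poly P) z = 0" if "z \<in> Z" for z
    proof -
      have "poly (map_poly of_rat q) z = 0" using that by (simp add: Z_def h(1) of_rat_of_int_poly)
      then show *: "poly (map_poly of_rat g) z = 0" unfolding g' by (simp add: map_poly_of_rat_mult)
      then show "poly (of_int_poly P) z = 0" unfolding P_eq by simp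
    qed
    have card: "card Z = degree h"
      using card_roots_minimal_poly[OF q] by (simp add: Z_def h(1) of_rat_of_int_poly)
    have wZ: "w \<in> Z" using q by (simp add: Z_def h(1) of_rat_of_int_poly is_minimal_poly_def)
    have deg: "degree h > 0"
    proof (rule Nat.gr0I)
      assume "degree h = 0"
      then have "h = 1" using h(2) by (auto elim: degree_eq_zeroE)
      then show False using wZ by (simp add: Z_def)
    qed
    have "norm z \<le> 1" if "z \<in> Z" for z
    proof (rule root_norm_le_1[OF Z(2)[OF that]], rule notI)
      assume "z = of_real \<alpha>"
      then have "poly (map_poly of_rat g) \<alpha> = 0" using Z(1)[OF that] by (simp add: of_rat_poly_of_real)
      then show False using real_root_simple[OF \<alpha>1 P_eq p(2)] by simp
    qed
    moreover have "0 \<notin> Z" using Z(2)[of 0] poly_P_0[where 'a = complex] by auto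
    ultimately obtain n :: nat where "n > 0" "cis (2 * pi / real n) \<in> Z"
      using ex_primitive_root_of_unity_root[of h] h(2) deg card unfolding Z_def by blast
    then show False using poly_P_root_of_unity Z(2) by blast
  qed
  then have "g = 1" using lc by (auto elim: degree_eq_zeroE)
  then show ?thesis using g by (simp add: p_def)
qed

lemma conjugates_alpha: "conjugates \<alpha> = {z. poly (of_int_poly P) z = 0}"
  by (simp add: conjugates_def minimal_poly_alpha of_rat_of_int_poly)

text \<open>Otherwise each conjugate other than \<alpha> lies inside the disc and its reciprocal is
  a zero outside, hence \<alpha>. That leaves at most two conjugates, while \<open>P\<close> has at
  least three distinct zeros.\<close>

lemma ex_conjugate_norm_1: "\<exists>z\<in>conjugates \<alpha>. norm z = 1"
proof (rule ccontr)
  assume no: "\<not> ?thesis"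
  have "conjugates \<alpha> \<subseteq> {of_real \<alpha>, 1 / of_real \<alpha>}"
  proof
    fix z assume "z \<in> conjugates \<alpha>"
    then have z: "poly (of_int_poly P) z = 0" "norm z \<noteq> 1" using no by (auto simp: conjugates_alpha)
    show "z \<in> {of_real \<alpha>, 1 / of_real \<alpha>}"
    proof (cases "z = of_real \<alpha>")
      case False
      then have "norm z < 1" using root_norm_le_1[OF z(1)] z(2) by simp
      moreover have "z \<noteq> 0" using z(1) poly_P_0[where 'a = complex] by auto
      ultimately have "norm (1 / z) > 1" by (simp add: norm_divide)
      then have "1 / z = of_real \<alpha>" using root_norm_le_1[OF root_reciprocal[OF z(2,1)]] by force
      then have "z = 1 / of_real \<alpha>" by (metis div_by_1 divide_divide_eq_right mult_1)
      then show ?thesis by simp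
    qed simp
  qed
  then have "card (conjugates \<alpha>) \<le> card {complex_of_real \<alpha>, 1 / of_real \<alpha>}"
    by (intro card_mono) auto
  also have "\<dots> \<le> 2" by (simp add: card_insert_if)
  finally have "degree P \<le> 2"
    using card_roots_minimal_poly[OF is_minimal_poly_alpha] by (simp add: conjugates_def minimal_poly_alpha)
  then show False by (simp add: coeff_P)
qed

lemma salem_number_alpha: "salem_number \<alpha>"
  unfolding salem_number_def using algebraic_int_alpha \<alpha>1 ex_conjugate_norm_1 root_norm_le_1
  by (auto simp: conjugates_alpha)

lemma alg_degree_alpha: "alg_degree \<alpha> = 3 + (\<Sum>i\<in>I. a i - 1)"
  by (simp add: alg_degree_def minimal_poly_alpha coeff_P degree_U)

lemma alg_trace_alpha: "alg_trace \<alpha> = 2 - of_nat m"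
proof -
  have "coeff P (degree P - 1) = int m - 2" using coeff_P by simp
  then have "- alg_trace \<alpha> = of_int (int m - 2)"
    using coeff_monic_eq_neg_sum_roots[of "of_int_poly P"] lead_coeff_P coeff_P(2)
    by (simp add: alg_trace_def minimal_poly_alpha of_rat_of_int_poly coeff_map_poly)
  then have "alg_trace \<alpha> = - of_int (int m - 2)" by (metis minus_minus)
  then show ?thesis by simp
qed

end

lemma ex_salem_number:
  "\<exists>\<alpha>. salem_number \<alpha> \<and> alg_trace \<alpha> = 2 - of_nat m \<and> alg_degree \<alpha> = 3 + (\<Sum>i<2*m. a i - 1)"
  using ex_real_root salem_number_alpha alg_trace_alpha alg_degree_alpha by blast

end

section \<open>The exponents\<close>

text \<open>The exponents from index 2 on, minus 1. The initial factorial is divisible by all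
  \<open>1 + r\<close> and \<open>2 + r\<close> with \<open>r < R\<close>; each step multiplies in
  the shifts \<open>a + r\<close> of the newest exponent \<open>a\<close>.\<close>

fun sylvester_like :: "nat \<Rightarrow> nat \<Rightarrow> nat" where
  "sylvester_like R 0 = fact (Suc R)"
| "sylvester_like R (Suc j) = sylvester_like R j * (\<Prod>r<R. sylvester_like R j + 1 + r)"

definition exponents :: "nat \<Rightarrow> nat \<Rightarrow> nat" where
  "exponents R i = (if i = 0 then 1 else if i = 1 then 2 else 1 + sylvester_like R (i - 2))"

lemma sylvester_like_pos: "sylvester_like R j > 0"
  by (induction j) auto

lemma sylvester_like_dvd: "i \<le> j \<Longrightarrow> sylvester_like R i dvd sylvester_like R j"
proof (induction j rule: dec_induct)
  case (step j)
  then show ?case by (simp add: dvd_mult2)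
qed simp

lemma exponents_dvd:
  assumes "i < j" "2 \<le> j" "r < R"
  shows "exponents R i + r dvd exponents R j - 1"
proof -
  note j = assms(2)
  have ej: "exponents R j - 1 = sylvester_like R (j - 2)" using j by (simp add: exponents_def)
  show ?thesis
  proof (cases "i < 2")
    case True
    have "exponents R i + r dvd fact (Suc R)"
      using True assms(3) by (intro dvd_fact) (auto simp: exponents_def)
    also have "fact (Suc R) dvd sylvester_like R (j - 2)"
      using sylvester_like_dvd[of 0 "j - 2" R] by simp
    finally show ?thesis unfolding ej .
  next
    case False
    define l where "l = i - 2"
    have ei: "exponents R i + r = sylvester_like R l + 1 + r" using False by (simp add: exponents_def l_def)
    have "exponents R i + r dvd (\<Prod>r<R. sylvester_like R l + 1 + r)"
      unfolding ei using assms(3) by (intro dvd_prodI) auto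
    then have "exponents R i + r dvd sylvester_like R (Suc l)" by (simp add: dvd_mult)
    also have "\<dots> dvd sylvester_like R (j - 2)"
      using assms(1) False by (intro sylvester_like_dvd) (auto simp: l_def)
    finally show ?thesis unfolding ej .
  qed
qed

section \<open>Growth of the exponents\<close>

lemma two_power_le_fact_Suc: "2 ^ R \<le> (fact (Suc R) :: nat)"
  by (induction R) (auto simp: algebra_simps intro: add_mono mult_le_mono)

lemma sylvester_like_mono: "sylvester_like R 0 \<le> sylvester_like R j"
  by (rule dvd_imp_le[OF sylvester_like_dvd sylvester_like_pos]) simp

text \<open>With \<open>b\<close> the current term, each of the \<open>R\<close> new factors is at
  most \<open>2 * b\<close>, and \<open>2 ^ R \<le> b\<close>; so one step at most raises
  \<open>b\<close> to the power \<open>R + 2\<close>.\<close>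

lemma sylvester_like_le:
  "sylvester_like R j \<le> fact (Suc R) ^ ((R + 2) ^ j)"
proof (induction j)
  case (Suc j)
  let ?b = "sylvester_like R j"
  have R: "R \<le> ?b" "2 ^ R \<le> ?b"
  proof -
    have "fact (Suc R) \<le> ?b" using sylvester_like_mono[of R j] by simp
    moreover have "Suc R \<le> fact (Suc R)" by (rule fact_ge_self)
    ultimately show "R \<le> ?b" by linarith
    show "2 ^ R \<le> ?b" using two_power_le_fact_Suc[of R] \<open>fact (Suc R) \<le> ?b\<close> by (rule order_trans)
  qed
  have "(\<Prod>r<R. ?b + 1 + r) \<le> (\<Prod>r<R. 2 * ?b)"
    using R(1) by (intro prod_mono) auto
  also have "\<dots> = 2 ^ R * ?b ^ R" by (simp add: power_mult_distrib)
  also have "\<dots> \<le> ?b * ?b ^ R" using R(2) by (rule mult_right_mono) simp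
  finally have "sylvester_like R (Suc j) \<le> ?b * (?b * ?b ^ R)" by simp
  also have "\<dots> = ?b ^ (R + 2)" by simp
  also have "\<dots> \<le> (fact (Suc R) ^ ((R + 2) ^ j)) ^ (R + 2)" using Suc.IH by (rule power_mono) simp
  also have "\<dots> = fact (Suc R) ^ ((R + 2) ^ Suc j)" by (simp only: power_mult[symmetric] power_Suc mult.commute)
  finally show ?case .
qed simp

text \<open>The sequence at least doubles at each step, so a term absorbs the sum of its
  predecessors. The 4 is the contribution to the degree of everything but the exponents from index 2
  on.\<close>

lemma sum_sylvester_like_le:
  assumes "R \<ge> 2"
  shows "4 + (\<Sum>i<j. sylvester_like R i) \<le> sylvester_like R j"
proof (induction j)
  case 0
  have "(fact 3 :: nat) \<le> fact (Suc R)" using assms by (intro fact_mono) simp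
  then show ?case by (simp add: fact_numeral)
next
  case (Suc j)
  let ?b = "sylvester_like R j"
  have "2 \<le> (\<Prod>r<R. ?b + 1 + r)"
  proof -
    have "2 \<le> ?b + 1 + 0" using sylvester_like_pos[of R j] by simp
    also have "?b + 1 + 0 dvd (\<Prod>r<R. ?b + 1 + r)" using assms by (intro dvd_prodI) auto
    then have "?b + 1 + 0 \<le> (\<Prod>r<R. ?b + 1 + r)" by (rule dvd_imp_le) (simp add: prod_pos)
    finally show ?thesis .
  qed
  then have "?b * 2 \<le> sylvester_like R (Suc j)"
    unfolding sylvester_like.simps by (rule mult_left_mono) simp
  then show ?case using Suc.IH by (simp del: sylvester_like.simps)
qed

section \<open>Comparison with the double exponential\<close>

lemma ln_le_of_le_exp: "0 < x \<Longrightarrow> x \<le> exp y \<Longrightarrow> ln x \<le> (y::real)"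
  by (metis exp_gt_zero ln_exp ln_le_cancel_iff)

text \<open>With \<open>Y = 4 * T + 6\<close>, the factorial is at most \<open>Y ^ Y\<close>, and
  \<open>Y \<le> exp Y\<close> bounds the left side by \<open>exp (Y ^ (2 * T + 4))\<close>. It
  remains to compare \<open>(2 * T + 4) * ln Y\<close> with the inner exponent.\<close>

lemma double_exponential_bound:
  fixes T :: nat
  assumes T: "T \<ge> 1"
  shows "real (fact (4 * T + 5) ^ ((4 * T + 6) ^ (2 * T + 2)))
      \<le> exp (exp (22 + 4 * real T * ln (real T)))"
proof -
  define Y where "Y = 4 * T + 6"
  have Y: "real Y > 0" by (simp add: Y_def)
  have "(fact (4 * T + 5) :: nat) \<le> fact Y" by (intro fact_mono) (simp add: Y_def)
  also have "\<dots> \<le> Y ^ Y" using fact_le_power[of Y, where 'a = nat] by (simp only: of_nat_id)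
  finally have X: "real (fact (4 * T + 5)) \<le> real Y ^ Y" by (metis of_nat_le_iff of_nat_power)
  have "real (fact (4 * T + 5) ^ (Y ^ (2 * T + 2))) = real (fact (4 * T + 5)) ^ (Y ^ (2 * T + 2))" by simp
  also have "\<dots> \<le> (real Y ^ Y) ^ (Y ^ (2 * T + 2))" using X by (intro power_mono) auto
  also have "\<dots> = real Y ^ (Y * Y ^ (2 * T + 2))" by (simp add: power_mult)
  also have "\<dots> \<le> exp (real Y) ^ (Y * Y ^ (2 * T + 2))"
    using exp_ge_add_one_self[of "real Y"] by (intro power_mono) linarith+
  also have "\<dots> = exp (real Y ^ (2 * T + 4))"
    by (simp add: exp_of_nat_mult[symmetric] power_add power4_eq_xxxx power2_eq_square mult_ac)
  finally have 1: "real (fact (4 * T + 5) ^ (Y ^ (2 * T + 2))) \<le> exp (real Y ^ (2 * T + 4))" .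
  have "real Y ^ (2 * T + 4) = exp (real (2 * T + 4) * ln (real Y))"
    using Y by (simp only: exp_of_nat_mult exp_ln)
  also have "\<dots> \<le> exp (22 + 4 * real T * ln (real T))"
  proof (subst exp_le_cancel_iff)
    have e: "(27/10 :: real) \<le> exp 1" using e_approx_32 by (simp add: abs_if split: if_splits)
    consider "T = 1" | "T = 2" | "T \<ge> 3" using T by linarith
    then show "real (2 * T + 4) * ln (real Y) \<le> 22 + 4 * real T * ln (real T)"
    proof cases
      case 1
      have "(10::real) \<le> (27/10) ^ 3" by (simp add: power3_eq_cube)
      also have "\<dots> \<le> exp 1 ^ 3" using e by (intro power_mono) auto
      also have "\<dots> = exp 3" by (simp add: exp_of_nat_mult[symmetric])
      finally have "ln (10::real) \<le> 3" by (simp add: ln_le_of_le_exp)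
      then show ?thesis using 1 by (simp add: Y_def)
    next
      case 2
      have "(7::real) \<le> (27/10) ^ 2" by (simp add: power2_eq_square)
      also have "\<dots> \<le> exp 1 ^ 2" using e by (intro power_mono) auto
      also have "\<dots> = exp 2" by (simp add: exp_of_nat_mult[symmetric])
      finally have "ln (7::real) \<le> 2" by (simp add: ln_le_of_le_exp)
      \<comment> \<open>Splitting off \<open>ln 2\<close> matches the \<open>8 * ln 2\<close> on the
        right.\<close>
      moreover have "ln (14::real) = ln 7 + ln 2" using ln_mult[of 7 2] by simp
      ultimately show ?thesis using 2 by (simp add: Y_def)
    next
      case 3
      have "(6::real) \<le> (27/10) ^ 2" by (simp add: power2_eq_square)
      also have "\<dots> \<le> exp 1 ^ 2" using e by (intro power_mono) auto
      also have "\<dots> = exp 2" by (simp add: exp_of_nat_mult[symmetric])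
      finally have ln6: "ln (6::real) \<le> 2" by (simp add: ln_le_of_le_exp)
      have "real Y \<le> 6 * real T" using 3 by (simp add: Y_def)
      then have "ln (real Y) \<le> ln (6 * real T)" using Y T by simp
      also have "\<dots> = ln 6 + ln (real T)" using T by (simp add: ln_mult)
      finally have lnY: "ln (real Y) \<le> 2 + ln (real T)" using ln6 by simp
      have "real (2 * T + 4) * ln (real Y) \<le> real (2 * T + 4) * (2 + ln (real T))"
        using lnY by (intro mult_left_mono) auto
      also have "\<dots> \<le> 22 + 4 * real T * ln (real T)"
      proof -
        have e3: "exp 1 \<le> (28/10 :: real)" using e_approx_32 by (simp add: abs_if split: if_splits)
        \<comment> \<open>The lower bounds 1, 3/2 and 2 for \<open>ln T\<close> suffice on these
          ranges; the first two give equality at 5 and 8 respectively.\<close>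
        consider "T \<le> 5" | "T \<ge> 5" "T \<le> 8" | "T \<ge> 8" by linarith
        then have "4 * real T - 14 \<le> (2 * real T - 4) * ln (real T)"
        proof cases
          case 1
          have "exp 1 \<le> real T" using e3 3 by linarith
          then have "1 \<le> ln (real T)" using T by (simp add: ln_ge_iff)
          then have "(2 * real T - 4) * 1 \<le> (2 * real T - 4) * ln (real T)"
            using 3 by (intro mult_left_mono) auto
          then show ?thesis using 1 by simp
        next
          case 2
          have "exp (3 :: real) = exp 1 ^ 3" by (simp add: exp_of_nat_mult[symmetric])
          also have "\<dots> \<le> (28/10) ^ 3" using e3 by (intro power_mono) auto
          also have "\<dots> \<le> (real 5)\<^sup>2" by (simp add: power3_eq_cube power2_eq_square)
          also have "\<dots> \<le> (real T)\<^sup>2" using 2 by (intro power_mono) auto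
          finally have "3 \<le> ln ((real T)\<^sup>2)" using T by (simp add: ln_ge_iff)
          then have "3 / 2 \<le> ln (real T)" using T by (simp add: ln_realpow)
          then have "(2 * real T - 4) * (3 / 2) \<le> (2 * real T - 4) * ln (real T)"
            using 3 by (intro mult_left_mono) auto
          then show ?thesis using 2 by simp
        next
          case 3
          have "exp (2 :: real) = exp 1 ^ 2" by (simp add: exp_of_nat_mult[symmetric])
          also have "\<dots> \<le> (28/10) ^ 2" using e3 by (intro power_mono) auto
          also have "\<dots> \<le> real T" using 3 by (simp add: power2_eq_square)
          finally have "2 \<le> ln (real T)" using T by (simp add: ln_ge_iff)
          then have "(2 * real T - 4) * 2 \<le> (2 * real T - 4) * ln (real T)"
            using 3 by (intro mult_left_mono) auto
          then show ?thesis by simp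
        qed
        then show ?thesis by (simp add: algebra_simps)
      qed
      finally show ?thesis .
    qed
  qed
  finally have "real Y ^ (2 * T + 4) \<le> exp (22 + 4 * real T * ln (real T))" .
  then show ?thesis using 1 unfolding Y_def by (meson exp_le_cancel_iff order_trans)
qed

theorem theorem1:
  fixes T :: int
  assumes "T \<ge> 1"
  shows "\<exists>\<alpha>::real. salem_number \<alpha> \<and> alg_trace \<alpha> = of_int (- T) \<and>
           real (alg_degree \<alpha>) \<le> exp (exp (22 + 4 * real_of_int T * ln (real_of_int T)))"
proof -
  define t where "t = nat T"
  have t: "t \<ge> 1" "T = int t" using assms by (auto simp: t_def)
  \<comment> \<open>The trace \<open>2 - m\<close> becomes \<open>- t\<close>, and
    \<open>R = 4 * m - 4\<close> is the range of shifts in \<open>a_cong\<close>.\<close>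
  define m R where "m = t + 2" and "R = 4 * t + 4"
  interpret cotangent_family "exponents R" m
  proof
    show "exponents R i + r dvd exponents R j - 1" if "i < j" "2 \<le> j" "r < 4 * m - 4" for i j r
      using that by (intro exponents_dvd) (auto simp: R_def m_def)
  qed (auto simp: m_def exponents_def sylvester_like_pos)
  obtain \<alpha> where \<alpha>: "salem_number \<alpha>" "alg_trace \<alpha> = 2 - of_nat m"
    "alg_degree \<alpha> = 3 + (\<Sum>i<2*m. exponents R i - 1)"
    using ex_salem_number by blast
  have "(\<Sum>i<2*m. exponents R i - 1) = (\<Sum>i<Suc (Suc (2 * t + 2)). exponents R i - 1)"
    by (simp add: m_def)
  \<comment> \<open>Index 0 contributes 0 and index 1 contributes 1.\<close>
  also have "\<dots> = 1 + (\<Sum>i<2*t+2. sylvester_like R i)"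
    by (subst sum.lessThan_Suc_shift, subst sum.lessThan_Suc_shift) (simp add: exponents_def)
  finally have "alg_degree \<alpha> = 4 + (\<Sum>i<2*t+2. sylvester_like R i)"
    using \<alpha>(3) by simp
  also have "\<dots> \<le> sylvester_like R (2 * t + 2)"
    by (rule sum_sylvester_like_le) (simp add: R_def)
  also have "\<dots> \<le> fact (Suc R) ^ ((R + 2) ^ (2 * t + 2))" by (rule sylvester_like_le)
  also have "\<dots> = fact (4 * t + 5) ^ ((4 * t + 6) ^ (2 * t + 2))"
  proof -
    have "Suc R = 4 * t + 5" "R + 2 = 4 * t + 6" by (simp_all add: R_def)
    then show ?thesis by (simp only:)
  qed
  finally have "real (alg_degree \<alpha>) \<le> real (fact (4 * t + 5) ^ ((4 * t + 6) ^ (2 * t + 2)))"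
    by (simp only: of_nat_le_iff)
  also have "\<dots> \<le> exp (exp (22 + 4 * real t * ln (real t)))"
    by (rule double_exponential_bound[OF t(1)])
  finally have "real (alg_degree \<alpha>) \<le> exp (exp (22 + 4 * real_of_int T * ln (real_of_int T)))"
    by (simp add: t(2))
  moreover have "alg_trace \<alpha> = of_int (- T)" using \<alpha>(2) by (simp add: m_def t(2))
  ultimately show ?thesis using \<alpha>(1) by blast
qed

end
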